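(* Let $n,d\in\mathbb{N}$, $\lambda\ge1$ and $\beta\in(0,1]$. If $\mathsf{M}\colon[0,1]\times(\mathcal{S}_d)^n\to\mathcal{S}_d$ is a $(\lambda,\beta)$-estimator of top singular vector and $\mathsf{M}(\gamma,\cdot)$ is $\left(1,\frac{\beta}{4n}\right)$-differentially private for every $\gamma\in[0,1]$, then $$n\ge\Omega\!\left(\frac{\sqrt d/\lambda}{\log^{1.5}\!\left(\frac{d}{\beta\lambda}\right)}\right).$$
   Context: $\mathcal{S}_d=\{v\in\mathbb{R}^d:\|v\|_2=1\}$. An input $(x_1,\dots,x_n)\in(\mathcal{S}_d)^n$ is identified with the $n\times d$ matrix $X$ whose rows are the $x_i$; $\sigma_1(X)\ge\sigma_2(X)\ge\dots$ are its singular values and its top right singular vector $v\in\mathcal{S}_d$ maximizes $\|Xv\|_2$. $\mathsf{M}$ is a $(\lambda,\beta)$-estimator of top singular vector if for every $X\in(\mathcal{S}_d)^n$ and every $\gamma\in[0,1]$ with $\sigma_2(X)\le\gamma\sigma_1(X)$, it outputs $y\in\mathcal{S}_d$ with $\Pr_{y\sim\mathsf{M}(\gamma,X)}[\|Xy\|_2^2\ge\|Xv\|_2^2-\lambda\gamma n]\ge\beta$. A mechanism is $(\varepsilon,\delta)$-differentially private if for every two datasets differing in exactly one row and every output set $T$, $\Pr[\mathsf{M}(X)\in T]\le e^{\varepsilon}\Pr[\mathsf{M}(X')\in T]+\delta$. $\Omega(\cdot)$ hides a positive absolute constant.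
   Formalization: The logarithm is taken of max(2, d/(βλ)) and n ≥ 1 is assumed: read literally, the bound fails (d=n=λ=1, constant M, β→1 makes log(d/(βλ))→0) or is undefined (d/(βλ)<1, or n=0 in β/(4n)). *)

theory Defs
  imports "HOL-Analysis.Analysis" "HOL-Probability.Probability"
begin

text \<open>Vectors of R^d are represented as functions nat => real vanishing outside {..<d}.\<close>

definition unit_sphere_d :: "nat \<Rightarrow> (nat \<Rightarrow> real) set" where
  "unit_sphere_d d = {v. (\<forall>i\<ge>d. v i = 0) \<and> (\<Sum>i<d. (v i)^2) = 1}"

text \<open>Datasets (S_d)^n: lists of n rows, each in S_d; X is the n x d matrix with rows X!i.\<close>
definition datasets :: "nat \<Rightarrow> nat \<Rightarrow> (nat \<Rightarrow> real) list set" where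
  "datasets d n = {X. length X = n \<and> (\<forall>i<n. X ! i \<in> unit_sphere_d d)}"

definition Xnorm2 :: "nat \<Rightarrow> (nat \<Rightarrow> real) list \<Rightarrow> (nat \<Rightarrow> real) \<Rightarrow> real" where
  "Xnorm2 d X y = (\<Sum>i<length X. (\<Sum>j<d. (X ! i) j * y j)^2)"

definition gram_apply :: "nat \<Rightarrow> (nat \<Rightarrow> real) list \<Rightarrow> (nat \<Rightarrow> real) \<Rightarrow> (nat \<Rightarrow> real)" where
  "gram_apply d X u = (\<lambda>k. if k < d then (\<Sum>i<length X. (X ! i) k * (\<Sum>j<d. (X ! i) j * u j)) else 0)"

definition is_sv_seq :: "nat \<Rightarrow> (nat \<Rightarrow> real) list \<Rightarrow> (nat \<Rightarrow> real) \<Rightarrow> bool" where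
  "is_sv_seq d X s \<longleftrightarrow>
     (\<forall>j\<ge>d. s j = 0) \<and> (\<forall>j. 0 \<le> s j) \<and> (\<forall>j k. j \<le> k \<longrightarrow> s k \<le> s j) \<and>
     (\<exists>u :: nat \<Rightarrow> nat \<Rightarrow> real.
        (\<forall>j<d. u j \<in> unit_sphere_d d) \<and>
        (\<forall>j<d. \<forall>k<d. j \<noteq> k \<longrightarrow> (\<Sum>l<d. u j l * u k l) = 0) \<and>
        (\<forall>j<d. gram_apply d X (u j) = (\<lambda>l. (s j)^2 * u j l)))"

text \<open>singular_value d X k = sigma_{k+1}(X) (0-indexed).\<close>
definition singular_value :: "nat \<Rightarrow> (nat \<Rightarrow> real) list \<Rightarrow> nat \<Rightarrow> real" where
  "singular_value d X k = (THE s. is_sv_seq d X s) k"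

text \<open>M gamma X is the output distribution: a probability measure on the Borel sets of
  nat => real, concentrated on S_d.\<close>
definition valid_mechanism :: "nat \<Rightarrow> nat \<Rightarrow> (real \<Rightarrow> (nat \<Rightarrow> real) list \<Rightarrow> (nat \<Rightarrow> real) measure) \<Rightarrow> bool" where
  "valid_mechanism d n M \<longleftrightarrow>
     (\<forall>\<gamma>\<in>{0..1}. \<forall>X\<in>datasets d n.
        prob_space (M \<gamma> X) \<and> sets (M \<gamma> X) = sets borel \<and> measure (M \<gamma> X) (unit_sphere_d d) = 1)"

definition top_sv_estimator ::
  "real \<Rightarrow> real \<Rightarrow> nat \<Rightarrow> nat \<Rightarrow> (real \<Rightarrow> (nat \<Rightarrow> real) list \<Rightarrow> (nat \<Rightarrow> real) measure) \<Rightarrow> bool" where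
  "top_sv_estimator lam beta d n M \<longleftrightarrow>
     (\<forall>X\<in>datasets d n. \<forall>\<gamma>\<in>{0..1}.
        singular_value d X 1 \<le> \<gamma> * singular_value d X 0 \<longrightarrow>
        (\<forall>v\<in>unit_sphere_d d. (\<forall>y\<in>unit_sphere_d d. Xnorm2 d X y \<le> Xnorm2 d X v) \<longrightarrow>
           measure (M \<gamma> X) {y \<in> unit_sphere_d d. Xnorm2 d X y \<ge> Xnorm2 d X v - lam * \<gamma> * real n}
             \<ge> beta))"

definition neighbors :: "(nat \<Rightarrow> real) list \<Rightarrow> (nat \<Rightarrow> real) list \<Rightarrow> bool" where
  "neighbors X X' \<longleftrightarrow> length X = length X' \<and> card {i. i < length X \<and> X ! i \<noteq> X' ! i} = 1"

definition diff_private ::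
  "real \<Rightarrow> real \<Rightarrow> (nat \<Rightarrow> real) list set \<Rightarrow> ((nat \<Rightarrow> real) list \<Rightarrow> (nat \<Rightarrow> real) measure) \<Rightarrow> bool" where
  "diff_private eps delta D Mech \<longleftrightarrow>
     (\<forall>X\<in>D. \<forall>X'\<in>D. neighbors X X' \<longrightarrow>
        (\<forall>T\<in>sets borel. measure (Mech X) T \<le> exp eps * measure (Mech X') T + delta))"

end

theory Submission
  imports Defs
begin

text \<open>
  Hard instances are \<open>n \<times> m\<close> sign matrices with independent columns; row \<open>x\<close> is embedded as the unit
  vector \<open>(1 / sqrt 2, x / sqrt (2 m))\<close>, whose fixed first coordinate resolves the sign ambiguity of a
  singular vector. With probability \<open>1 - \<eta>\<close>, where \<open>\<eta> ~ 1 / lam^2\<close>, a column is constant; otherwise its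
  entries have common mean \<open>p = tanh \<theta>\<close> with \<open>\<theta>\<close> uniform on an interval of length \<open>T = ln (100 n)\<close>. Few
  columns are non-constant, so the matrix is nearly of rank one, and the signs of an accurate answer agree
  with most of the constant columns.

  By the fundamental theorem of calculus in \<open>\<theta>\<close>, this agreement forces the expected score
  \<open>\<Sum>j. f j * (\<Sum>i. x i j - p j)\<close> of the answer signs \<open>f\<close> to be of order \<open>\<eta> m / T\<close>. Given the matrix the
  biases of different columns are independent, so an exponential moment bound, which factors over the
  columns, makes the score large except with probability far below \<open>beta\<close>. Hence some row has correlation at
  least of order \<open>\<eta> m / (n T)\<close> with the answer with probability of order \<open>beta / n\<close>. By differential privacy the same
  holds for a fresh row independent of the answer, whose correlation has subgaussian fluctuations of order
  \<open>sqrt (\<eta> m)\<close>; this bounds \<open>n\<close> from below. A finite grid replaces the uniform distribution of \<open>\<theta>\<close>, so that only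
  finitely many datasets and biases occur and no measurability of the mechanism in its input is needed.
\<close>

section \<open>Singular values via Rayleigh quotients\<close>

text \<open>Elimination by induction on the number of equations: an equation \<open>j0\<close> that
  contains the last unknown is solved for it and substituted into the others. If no equation
  contains it, the last unit vector is a solution. All dimension counts of this section reduce to
  this fact.\<close>

lemma homogeneous_system_nontrivial:
  fixes a :: "nat \<Rightarrow> nat \<Rightarrow> real"
  shows "\<exists>c. (\<exists>i\<le>k. c i \<noteq> 0) \<and> (\<forall>j<k. (\<Sum>i\<le>k. a j i * c i) = 0)"
proof (induction k arbitrary: a)
  case 0
  show ?case by (rule exI[of _ "\<lambda>_. 1"]) auto
next
  case (Suc k)
  show ?case
  proof (cases "\<forall>j<Suc k. a j (Suc k) = 0")
    case True
    then show ?thesis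
      by (intro exI[of _ "\<lambda>i. if i = Suc k then 1 else 0"]) auto
  next
    case False
    then obtain j0 where j0: "j0 < Suc k" "a j0 (Suc k) \<noteq> 0" by blast
    \<comment> \<open>\<open>\<sigma>\<close> enumerates the equations other than \<open>j0\<close>,
      and \<open>a'\<close> is the system left after the last unknown has been eliminated.\<close>
    define \<sigma> where "\<sigma> j = (if j < j0 then j else Suc j)" for j
    define a' where "a' j i = a (\<sigma> j) i - a (\<sigma> j) (Suc k) / a j0 (Suc k) * a j0 i" for j i
    obtain c where c: "\<exists>i\<le>k. c i \<noteq> 0" "\<forall>j<k. (\<Sum>i\<le>k. a' j i * c i) = 0"
      using Suc.IH[of a'] by blast
    define c' where "c' = c(Suc k := - (\<Sum>i\<le>k. a j0 i * c i) / a j0 (Suc k))"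
    have c'_sum: "(\<Sum>i\<le>Suc k. a j i * c' i)
        = (\<Sum>i\<le>k. a j i * c i) - a j (Suc k) / a j0 (Suc k) * (\<Sum>i\<le>k. a j0 i * c i)" for j
      by (simp add: c'_def)
    have "(\<Sum>i\<le>Suc k. a j i * c' i) = 0" if "j < Suc k" for j
    proof (cases "j = j0")
      case True
      then show ?thesis unfolding c'_sum using j0 by simp
    next
      case False
      define j' where "j' = (if j < j0 then j else j - 1)"
      have "j' < k" "\<sigma> j' = j"
        using False that j0 by (auto simp: j'_def \<sigma>_def)
      then have "(\<Sum>i\<le>k. a' j' i * c i) = 0" using c by blast
      then show ?thesis
        unfolding c'_sum using \<open>\<sigma> j' = j\<close>
        by (simp add: a'_def sum_subtractf algebra_simps sum_distrib_left)
    qed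
    moreover have "\<exists>i\<le>Suc k. c' i \<noteq> 0"
    proof -
      obtain i where "i \<le> k" "c i \<noteq> 0" using c(1) by blast
      then show ?thesis by (intro exI[of _ i]) (simp add: c'_def)
    qed
    ultimately show ?thesis by blast
  qed
qed

section \<open>Inner products and the Gram form\<close>

definition ip :: "nat \<Rightarrow> (nat \<Rightarrow> real) \<Rightarrow> (nat \<Rightarrow> real) \<Rightarrow> real" where
  "ip d u v = (\<Sum>l<d. u l * v l)"

lemma ip_commute: "ip d u v = ip d v u"
  by (simp add: ip_def mult.commute)

lemma ip_add_left: "ip d (\<lambda>l. u l + w l) v = ip d u v + ip d w v"
  by (simp add: ip_def distrib_right sum.distrib)

lemma ip_diff_left: "ip d (\<lambda>l. u l - w l) v = ip d u v - ip d w v"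
  by (simp add: ip_def left_diff_distrib sum_subtractf)

lemma ip_scale_left: "ip d (\<lambda>l. a * u l) v = a * ip d u v"
  by (simp add: ip_def sum_distrib_left mult_ac)

lemma ip_sum_left: "ip d (\<lambda>l. \<Sum>i\<in>S. c i * u i l) v = (\<Sum>i\<in>S. c i * ip d (u i) v)"
  unfolding ip_def sum_distrib_right sum_distrib_left by (subst sum.swap) (simp add: mult_ac)

lemma ip_add_right: "ip d v (\<lambda>l. u l + w l) = ip d v u + ip d v w"
  by (simp add: ip_commute[of d v] ip_add_left)

lemma ip_diff_right: "ip d v (\<lambda>l. u l - w l) = ip d v u - ip d v w"
  by (simp add: ip_commute[of d v] ip_diff_left)

lemma ip_scale_right: "ip d v (\<lambda>l. a * u l) = a * ip d v u"
  by (simp add: ip_commute[of d v] ip_scale_left)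

lemma ip_sum_right: "ip d v (\<lambda>l. \<Sum>i\<in>S. c i * u i l) = (\<Sum>i\<in>S. c i * ip d v (u i))"
  by (simp add: ip_commute[of d v] ip_sum_left)

lemma ip_self_nonneg: "ip d u u \<ge> 0"
  by (simp add: ip_def sum_nonneg)

lemma ip_self_eq_0: "ip d u u = 0 \<longleftrightarrow> (\<forall>l<d. u l = 0)"
  by (auto simp: ip_def sum_nonneg_eq_0_iff)

lemma ip_Cauchy_Schwarz: "(ip d u v)\<^sup>2 \<le> ip d u u * ip d v v"
  unfolding ip_def power2_eq_square[symmetric] by (rule Cauchy_Schwarz_ineq_sum)

lemma unit_sphere_d_iff: "v \<in> unit_sphere_d d \<longleftrightarrow> (\<forall>i\<ge>d. v i = 0) \<and> ip d v v = 1"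
  by (simp add: unit_sphere_d_def ip_def power2_eq_square)

lemma Xnorm2_ip: "Xnorm2 d X y = (\<Sum>i<length X. (ip d (X ! i) y)\<^sup>2)"
  by (simp add: Xnorm2_def ip_def)

lemma Xnorm2_nonneg: "Xnorm2 d X y \<ge> 0"
  by (simp add: Xnorm2_ip sum_nonneg)

lemma Xnorm2_scale: "Xnorm2 d X (\<lambda>l. a * u l) = a\<^sup>2 * Xnorm2 d X u"
  by (simp add: Xnorm2_ip ip_scale_right power_mult_distrib sum_distrib_left)

lemma ip_gram_apply: "ip d (gram_apply d X u) w = (\<Sum>i<length X. ip d (X ! i) u * ip d (X ! i) w)"
proof -
  have "ip d (gram_apply d X u) w = ip d (\<lambda>l. \<Sum>i<length X. ip d (X ! i) u * (X ! i) l) w"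
    unfolding ip_def gram_apply_def by (intro sum.cong) (auto simp: mult.commute)
  then show ?thesis by (simp add: ip_sum_left)
qed

lemma ip_gram_apply_self: "ip d (gram_apply d X u) u = Xnorm2 d X u"
  by (simp add: ip_gram_apply Xnorm2_ip power2_eq_square)

lemma ip_gram_apply_commute: "ip d (gram_apply d X u) w = ip d (gram_apply d X w) u"
  by (simp add: ip_gram_apply mult.commute)

lemma Xnorm2_add:
  "Xnorm2 d X (\<lambda>l. u l + a * w l) = Xnorm2 d X u + 2 * a * ip d (gram_apply d X u) w + a\<^sup>2 * Xnorm2 d X w"
  unfolding Xnorm2_ip ip_gram_apply ip_add_right ip_scale_right sum_distrib_left sum.distrib[symmetric]
  by (intro sum.cong) (auto simp: power2_eq_square algebra_simps)

section \<open>Orthonormal families and the min-max comparison of eigenvalues\<close>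

definition orthonormal_family :: "nat \<Rightarrow> nat \<Rightarrow> (nat \<Rightarrow> nat \<Rightarrow> real) \<Rightarrow> bool" where
  "orthonormal_family d k u \<longleftrightarrow> (\<forall>j<k. u j \<in> unit_sphere_d d) \<and> (\<forall>j<k. \<forall>i<k. j \<noteq> i \<longrightarrow> ip d (u j) (u i) = 0)"

lemma orthonormal_family_ip:
  "orthonormal_family d k u \<Longrightarrow> i < k \<Longrightarrow> j < k \<Longrightarrow> ip d (u i) (u j) = (if i = j then 1 else 0)"
  by (auto simp: orthonormal_family_def unit_sphere_d_iff)

text \<open>The residual \<open>r\<close> is orthogonal to every \<open>u j\<close>. If it were
  nonzero, the \<open>u j\<close> together with \<open>r\<close> would be d + 1 pairwise orthogonal
  nonzero vectors with d coordinates, hence linearly dependent; pairing the dependence with each of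
  them makes every coefficient zero.\<close>

lemma orthonormal_basis_expansion:
  assumes u: "orthonormal_family d d u" and w: "\<forall>i\<ge>d. w i = 0"
  shows "w = (\<lambda>l. \<Sum>j<d. ip d w (u j) * u j l)"
proof -
  define r where "r = (\<lambda>l. w l - (\<Sum>j<d. ip d w (u j) * u j l))"
  have r_orth: "ip d r (u j) = 0" if "j < d" for j
  proof -
    have "ip d r (u j) = ip d w (u j) - (\<Sum>i<d. ip d w (u i) * ip d (u i) (u j))"
      by (simp add: r_def ip_diff_left ip_sum_left)
    also have "(\<Sum>i<d. ip d w (u i) * ip d (u i) (u j)) = (\<Sum>i<d. if i = j then ip d w (u i) else 0)"
      using orthonormal_family_ip[OF u] that by (intro sum.cong) auto
    finally show ?thesis using that by simp
  qed
  have "ip d r r = 0"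
  proof (rule ccontr)
    assume nz: "ip d r r \<noteq> 0"
    define v where "v = u(d := r)"
    obtain c where c: "\<exists>i\<le>d. c i \<noteq> 0" "\<forall>l<d. (\<Sum>i\<le>d. v i l * c i) = 0"
      using homogeneous_system_nontrivial[of d "\<lambda>l i. v i l"] by blast
    have zero: "(\<Sum>i\<le>d. c i * ip d (v i) x) = 0" for x
    proof -
      have "(\<Sum>i\<le>d. c i * ip d (v i) x) = ip d (\<lambda>l. \<Sum>i\<le>d. c i * v i l) x"
        by (simp add: ip_sum_left)
      also have "\<dots> = 0"
        unfolding ip_def using c(2) by (intro sum.neutral) (auto simp: mult.commute)
      finally show ?thesis .
    qed
    have "c j = 0" if "j \<le> d" for j
    proof (cases "j = d")
      case True
      have "(\<Sum>i<d. c i * ip d (v i) r) = 0"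
        using r_orth by (intro sum.neutral) (auto simp: v_def ip_commute)
      then show ?thesis using zero[of r] nz True
        by (simp add: lessThan_Suc_atMost[symmetric] v_def)
    next
      case False
      then have j: "j < d" using that by simp
      have "(\<Sum>i<d. c i * ip d (v i) (u j)) = (\<Sum>i<d. if i = j then c i else 0)"
        using orthonormal_family_ip[OF u] j by (intro sum.cong) (auto simp: v_def)
      then show ?thesis using zero[of "u j"] j r_orth[OF j]
        by (simp add: lessThan_Suc_atMost[symmetric] v_def)
    qed
    then show False using c(1) by auto
  qed
  then have "r l = 0" for l
    using w u by (cases "l < d") (auto simp: ip_self_eq_0 r_def orthonormal_family_def unit_sphere_d_iff)
  then show ?thesis by (auto simp: r_def fun_eq_iff)
qed

lemma ip_self_expansion:
  assumes u: "orthonormal_family d d u" and S: "S \<subseteq> {..<d}"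
  shows "ip d (\<lambda>l. \<Sum>j\<in>S. c j * u j l) (\<lambda>l. \<Sum>j\<in>S. c j * u j l) = (\<Sum>j\<in>S. (c j)\<^sup>2)"
proof -
  have fin: "finite S" using S finite_subset by blast
  have "ip d (\<lambda>l. \<Sum>j\<in>S. c j * u j l) (\<lambda>l. \<Sum>j\<in>S. c j * u j l)
      = (\<Sum>i\<in>S. c i * (\<Sum>j\<in>S. c j * ip d (u i) (u j)))"
    by (simp add: ip_sum_left ip_sum_right)
  also have "\<dots> = (\<Sum>i\<in>S. c i * (\<Sum>j\<in>S. if j = i then c j else 0))"
    using orthonormal_family_ip[OF u] subsetD[OF S]
    by (intro sum.cong arg_cong2[where f="(*)"] refl) auto
  also have "\<dots> = (\<Sum>i\<in>S. (c i)\<^sup>2)"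
    using fin by (simp add: power2_eq_square)
  finally show ?thesis .
qed

lemma Xnorm2_expansion:
  assumes u: "orthonormal_family d d u" and S: "S \<subseteq> {..<d}"
    and eig: "\<forall>j<d. gram_apply d X (u j) = (\<lambda>l. (s j)\<^sup>2 * u j l)"
  shows "Xnorm2 d X (\<lambda>l. \<Sum>j\<in>S. c j * u j l) = (\<Sum>j\<in>S. (s j)\<^sup>2 * (c j)\<^sup>2)"
proof -
  have fin: "finite S" using S finite_subset by blast
  define w where "w = (\<lambda>l. \<Sum>j\<in>S. c j * u j l)"
  have gw: "ip d (gram_apply d X w) (u j) = (s j)\<^sup>2 * c j" if "j \<in> S" for j
  proof -
    have "ip d (gram_apply d X w) (u j) = (s j)\<^sup>2 * ip d (u j) w"
      using eig S that by (subst ip_gram_apply_commute) (auto simp: ip_scale_left)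
    also have "ip d (u j) w = (\<Sum>i\<in>S. if i = j then c i else 0)"
      unfolding w_def ip_sum_right using orthonormal_family_ip[OF u] subsetD[OF S] that
      by (intro sum.cong) auto
    finally show ?thesis using fin that by simp
  qed
  have "Xnorm2 d X w = (\<Sum>j\<in>S. c j * ip d (gram_apply d X w) (u j))"
    unfolding ip_gram_apply_self[symmetric] by (subst (2) w_def) (simp add: ip_sum_right)
  also have "\<dots> = (\<Sum>j\<in>S. (s j)\<^sup>2 * (c j)\<^sup>2)"
    using gw by (intro sum.cong) (auto simp: power2_eq_square)
  finally show ?thesis by (simp add: w_def)
qed

lemma is_sv_seqE:
  assumes "is_sv_seq d X s"
  obtains u where "orthonormal_family d d u"
    "\<forall>j<d. gram_apply d X (u j) = (\<lambda>l. (s j)\<^sup>2 * u j l)"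
  using assms unfolding is_sv_seq_def orthonormal_family_def ip_def by (elim conjE exE) simp

text \<open>Upper half of the Courant-Fischer principle: the coefficients of \<open>w\<close> before
  index \<open>k\<close> vanish, and the eigenvalues from \<open>k\<close> on are at most
  \<open>(s k)^2\<close>.\<close>

lemma Xnorm2_upper:
  assumes u: "orthonormal_family d d u"
    and eig: "\<forall>j<d. gram_apply d X (u j) = (\<lambda>l. (s j)\<^sup>2 * u j l)"
    and s: "\<forall>j. 0 \<le> s j" "\<forall>j k. j \<le> k \<longrightarrow> s k \<le> s j"
    and w: "\<forall>i\<ge>d. w i = 0" "\<forall>j<k. ip d w (u j) = 0"
  shows "Xnorm2 d X w \<le> (s k)\<^sup>2 * ip d w w"
proof -
  note e = orthonormal_basis_expansion[OF u w(1)]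
  have "Xnorm2 d X w = (\<Sum>j<d. (s j)\<^sup>2 * (ip d w (u j))\<^sup>2)"
    by (subst e) (rule Xnorm2_expansion[OF u _ eig], simp)
  also have "\<dots> \<le> (\<Sum>j<d. (s k)\<^sup>2 * (ip d w (u j))\<^sup>2)"
  proof (rule sum_mono)
    fix j assume "j \<in> {..<d}"
    show "(s j)\<^sup>2 * (ip d w (u j))\<^sup>2 \<le> (s k)\<^sup>2 * (ip d w (u j))\<^sup>2"
      using w(2) s by (cases "j < k") (auto intro!: mult_right_mono power_mono)
  qed
  also have "\<dots> = (s k)\<^sup>2 * ip d w w"
    unfolding sum_distrib_left[symmetric]
    by (subst (2 3) e) (simp add: ip_self_expansion[OF u])
  finally show ?thesis .
qed

text \<open>Lower half of the Courant-Fischer principle: only eigenvalues of index at most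
  \<open>k\<close> enter, and each is at least \<open>(s k)^2\<close>.\<close>

lemma Xnorm2_lower:
  assumes u: "orthonormal_family d d u" and "k < d"
    and eig: "\<forall>j<d. gram_apply d X (u j) = (\<lambda>l. (s j)\<^sup>2 * u j l)"
    and s: "\<forall>j. 0 \<le> s j" "\<forall>j k. j \<le> k \<longrightarrow> s k \<le> s j"
    and w: "w = (\<lambda>l. \<Sum>j\<le>k. c j * u j l)"
  shows "(s k)\<^sup>2 * ip d w w \<le> Xnorm2 d X w"
proof -
  have S: "{..k} \<subseteq> {..<d}" using \<open>k < d\<close> by auto
  have "(s k)\<^sup>2 * ip d w w = (\<Sum>j\<le>k. (s k)\<^sup>2 * (c j)\<^sup>2)"
    by (simp add: w ip_self_expansion[OF u S] sum_distrib_left)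
  also have "\<dots> \<le> (\<Sum>j\<le>k. (s j)\<^sup>2 * (c j)\<^sup>2)"
    using s by (intro sum_mono mult_right_mono power_mono) auto
  also have "\<dots> = Xnorm2 d X w"
    by (simp add: w Xnorm2_expansion[OF u S eig])
  finally show ?thesis .
qed

text \<open>Orthogonality to \<open>v 0, ..., v (k - 1)\<close> imposes k linear equations on the k
  + 1 coefficients \<open>c\<close>, so a nonzero solution exists.\<close>

lemma span_meets_orthogonal_complement:
  assumes u: "orthonormal_family d d u" and "k < d"
  obtains w c where "w = (\<lambda>l. \<Sum>j\<le>k. c j * u j l)" "\<forall>i\<ge>d. w i = 0" "ip d w w > 0"
    "\<forall>j<k. ip d w (v j) = 0"
proof -
  obtain c where c: "\<exists>i\<le>k. c i \<noteq> 0" "\<forall>j<k. (\<Sum>i\<le>k. ip d (u i) (v j) * c i) = 0"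
    using homogeneous_system_nontrivial[of k "\<lambda>j i. ip d (u i) (v j)"] by blast
  define w where "w = (\<lambda>l. \<Sum>j\<le>k. c j * u j l)"
  have S: "{..k} \<subseteq> {..<d}" using \<open>k < d\<close> by auto
  have "\<forall>i\<ge>d. w i = 0"
    using u S by (auto simp: w_def orthonormal_family_def unit_sphere_d_iff intro!: sum.neutral)
  moreover have "ip d w w > 0"
  proof -
    obtain i where "i \<le> k" "c i \<noteq> 0" using c(1) by blast
    then have "(\<Sum>j\<le>k. (c j)\<^sup>2) > 0"
      by (intro sum_pos2[of _ i]) auto
    then show ?thesis by (simp add: w_def ip_self_expansion[OF u S])
  qed
  moreover have "\<forall>j<k. ip d w (v j) = 0"
    using c(2) by (simp add: w_def ip_sum_left mult.commute)
  ultimately show thesis using that w_def by blast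
qed

text \<open>Some nonzero vector lies in the span of the first k + 1 eigenvectors for
  \<open>s\<close> and is orthogonal to the first k eigenvectors for \<open>t\<close>; its Rayleigh
  quotient lies between \<open>(s k)^2\<close> and \<open>(t k)^2\<close>. By symmetry the sequence
  is unique, which gives meaning to the definite description in
  \<open>singular_value\<close>.\<close>

lemma is_sv_seq_le:
  assumes s: "is_sv_seq d X s" and t: "is_sv_seq d X t"
  shows "s k \<le> t k"
proof (cases "k < d")
  case True
  obtain u where u: "orthonormal_family d d u" "\<forall>j<d. gram_apply d X (u j) = (\<lambda>l. (s j)\<^sup>2 * u j l)"
    by (rule is_sv_seqE[OF s])
  obtain v where v: "orthonormal_family d d v" "\<forall>j<d. gram_apply d X (v j) = (\<lambda>l. (t j)\<^sup>2 * v j l)"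
    by (rule is_sv_seqE[OF t])
  have sp: "\<forall>j. 0 \<le> s j" "\<forall>j k. j \<le> k \<longrightarrow> s k \<le> s j" using s by (auto simp: is_sv_seq_def)
  have tp: "\<forall>j. 0 \<le> t j" "\<forall>j k. j \<le> k \<longrightarrow> t k \<le> t j" using t by (auto simp: is_sv_seq_def)
  obtain w c where w: "w = (\<lambda>l. \<Sum>j\<le>k. c j * u j l)" "\<forall>i\<ge>d. w i = 0" "ip d w w > 0"
    "\<forall>j<k. ip d w (v j) = 0"
    using span_meets_orthogonal_complement[OF u(1) True, of v] by blast
  have "(s k)\<^sup>2 * ip d w w \<le> (t k)\<^sup>2 * ip d w w"
    using Xnorm2_lower[OF u(1) True u(2) sp w(1)] Xnorm2_upper[OF v tp w(2,4)] by linarith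
  then have "(s k)\<^sup>2 \<le> (t k)\<^sup>2" using w(3) by simp
  then show ?thesis using tp(1) power2_le_imp_le by blast
next
  case False
  then show ?thesis using s t by (auto simp: is_sv_seq_def)
qed

section \<open>Existence of singular values by successive maximization\<close>

text \<open>In the product topology on sequences the sphere is a closed subset of a product of
  intervals [-1, 1] and points {0}, which is compact by Tychonoff.\<close>

lemma compact_unit_sphere_d: "compact (unit_sphere_d d)"
proof -
  define B :: "(nat \<Rightarrow> real) set" where "B = PiE UNIV (\<lambda>i. if i < d then {-1..1} else {0})"
  have "compact B"
    unfolding B_def compactin_euclidean_iff[symmetric] euclidean_product_topology[symmetric]
    by (subst compactin_PiE) (auto)
  moreover have "closed (unit_sphere_d d)"
  proof -
    have "unit_sphere_d d = (\<Inter>i\<in>{d..}. {v. v i = 0}) \<inter> {v. (\<Sum>i<d. (v i)\<^sup>2) = 1}"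
      by (auto simp: unit_sphere_d_def)
    moreover have "closed {v :: nat \<Rightarrow> real. v i = 0}" for i
      by (intro closed_Collect_eq continuous_intros) (auto intro: continuous_on_product_coordinates)
    moreover have "closed {v :: nat \<Rightarrow> real. (\<Sum>i<d. (v i)\<^sup>2) = 1}"
      by (intro closed_Collect_eq continuous_intros) (auto intro: continuous_on_product_coordinates)
    ultimately show ?thesis by (simp add: closed_INT closed_Int)
  qed
  moreover have "unit_sphere_d d \<subseteq> B"
  proof
    fix v assume v: "v \<in> unit_sphere_d d"
    have "\<bar>v i\<bar> \<le> 1" if "i < d" for i
    proof -
      have "(v i)\<^sup>2 \<le> (\<Sum>i<d. (v i)\<^sup>2)"
        using that by (intro member_le_sum) auto
      then show ?thesis using v by (simp add: unit_sphere_d_def abs_square_le_1)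
    qed
    then show "v \<in> B" using v by (auto simp: B_def unit_sphere_d_def abs_le_iff)
  qed
  ultimately show ?thesis
    by (metis compact_Int_closed inf.absorb_iff2)
qed

lemma continuous_on_ip: "continuous_on S (\<lambda>w. ip d v w)"
  unfolding ip_def
  by (intro continuous_intros continuous_on_subset[OF continuous_on_product_coordinates subset_UNIV])

lemma continuous_on_Xnorm2: "continuous_on S (Xnorm2 d X)"
  unfolding Xnorm2_ip[abs_def] by (intro continuous_intros continuous_on_ip)

text \<open>For small \<open>t\<close> of the sign of \<open>b\<close> the linear term outweighs the
  quadratic one. This is the first-order condition at the maximizer in
  \<open>next_eigenvector\<close>.\<close>

lemma quadratic_vertex_zero:
  fixes b c :: real
  assumes "\<And>t. 2 * t * b \<le> t\<^sup>2 * c"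
  shows "b = 0"
proof (rule ccontr)
  assume b: "b \<noteq> 0"
  define D where "D = \<bar>c\<bar> + 1"
  have D: "D > 0" "c < 2 * D" by (auto simp: D_def)
  have "2 * (b / D) * b \<le> (b / D)\<^sup>2 * c" by (rule assms)
  then have "2 * b\<^sup>2 * D \<le> b\<^sup>2 * c"
    using D(1) by (simp add: field_simps power2_eq_square)
  then have "2 * D \<le> c" using b by (simp add: mult.assoc mult.left_commute[of 2])
  then show False using D by simp
qed

text \<open>Let \<open>x\<close> maximize the Rayleigh quotient on the unit vectors orthogonal to
  the earlier eigenvectors, with maximum \<open>m\<close>. The Gram map is symmetric, so it
  preserves that orthogonal complement, and the residual \<open>g\<close> stays inside it. Moving
  \<open>x\<close> along \<open>g\<close> changes the quotient to first order by a multiple of the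
  squared norm of \<open>g\<close>, so \<open>g\<close> vanishes and \<open>x\<close> is an
  eigenvector.\<close>

lemma next_eigenvector:
  assumes u: "orthonormal_family d k u" and k: "k < d"
    and eig: "\<forall>j<k. gram_apply d X (u j) = (\<lambda>l. (s j)\<^sup>2 * u j l)"
  obtains x \<mu> where "x \<in> unit_sphere_d d" "\<forall>j<k. ip d x (u j) = 0" "\<mu> \<ge> 0"
    "gram_apply d X x = (\<lambda>l. \<mu>\<^sup>2 * x l)"
    "\<forall>w\<in>unit_sphere_d d. (\<forall>i<k. ip d w (u i) = 0) \<longrightarrow> Xnorm2 d X w \<le> \<mu>\<^sup>2"
proof -
  define W where "W = unit_sphere_d d \<inter> {w. \<forall>j\<in>{..<k}. ip d (u j) w = 0}"
  have "closed (\<Inter>j\<in>{..<k}. {w. ip d (u j) w = 0})"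
    by (intro closed_INT ballI closed_Collect_eq continuous_on_ip continuous_on_const)
  moreover have "(\<Inter>j\<in>{..<k}. {w. ip d (u j) w = 0}) = {w. \<forall>j\<in>{..<k}. ip d (u j) w = 0}" by auto
  ultimately have "compact W"
    unfolding W_def using compact_Int_closed[OF compact_unit_sphere_d] by simp
  have scale: "(\<lambda>l. w l / sqrt (ip d w w)) \<in> W"
    if w: "\<forall>i\<ge>d. w i = 0" "\<forall>j<k. ip d w (u j) = 0" "ip d w w > 0" for w
  proof -
    define a where "a = 1 / sqrt (ip d w w)"
    have "a * (a * ip d w w) = 1" using w(3) by (simp add: a_def field_simps)
    then have "(\<lambda>l. a * w l) \<in> W"
      using w by (auto simp: W_def unit_sphere_d_iff ip_scale_left ip_scale_right ip_commute)
    then show ?thesis by (simp add: a_def)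
  qed
  \<comment> \<open>The standard basis is an orthonormal family of full length; since k < d, its
    span contains a nonzero vector orthogonal to all \<open>u j\<close>.\<close>
  have "W \<noteq> {}"
  proof -
    define e where "e i = (\<lambda>l. if l = i then 1 else 0 :: real)" for i :: nat
    have "orthonormal_family d d e"
    proof -
      have "ip d (e i) (e j) = (if i = j then 1 else 0)" if "j < d" for i j
      proof -
        have "ip d (e i) (e j) = (\<Sum>l<d. if l = j then (if i = j then 1 else 0) else 0)"
          unfolding ip_def e_def by (intro sum.cong) auto
        then show ?thesis using that by simp
      qed
      then show ?thesis
        by (simp add: orthonormal_family_def unit_sphere_d_iff) (simp add: e_def)
    qed
    from span_meets_orthogonal_complement[OF this k, of u]
    obtain w c where "w = (\<lambda>l. \<Sum>j\<le>k. c j * e j l)" "\<forall>i\<ge>d. w i = 0" "ip d w w > 0"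
      "\<forall>j<k. ip d w (u j) = 0" .
    then show ?thesis using scale[of w] by auto
  qed
  obtain x where x: "x \<in> W" "\<forall>w\<in>W. Xnorm2 d X w \<le> Xnorm2 d X x"
    using continuous_attains_sup[OF \<open>compact W\<close> \<open>W \<noteq> {}\<close> continuous_on_Xnorm2] by blast
  define m where "m = Xnorm2 d X x"
  have xs: "\<forall>i\<ge>d. x i = 0" "ip d x x = 1" "\<forall>j<k. ip d x (u j) = 0"
    using x(1) by (auto simp: W_def unit_sphere_d_iff ip_commute)
  have max: "Xnorm2 d X w \<le> m * ip d w w" if w: "\<forall>i\<ge>d. w i = 0" "\<forall>j<k. ip d w (u j) = 0" for w
  proof (cases "ip d w w = 0")
    case True
    then have "\<forall>l<d. w l = 0" by (simp add: ip_self_eq_0)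
    then have "Xnorm2 d X w = 0"
      by (simp add: Xnorm2_ip ip_def)
    then show ?thesis using True by simp
  next
    case False
    then have pos: "ip d w w > 0" using ip_self_nonneg[of d w] by simp
    have "Xnorm2 d X (\<lambda>l. (1 / sqrt (ip d w w)) * w l) \<le> m"
      using scale[OF w pos] x(2) by (simp add: m_def)
    then have "(1 / sqrt (ip d w w))\<^sup>2 * Xnorm2 d X w \<le> m" by (simp only: Xnorm2_scale)
    then show ?thesis using pos by (simp add: power_divide field_simps)
  qed
  define g where "g = (\<lambda>l. gram_apply d X x l - m * x l)"
  have g0: "\<forall>i\<ge>d. g i = 0" using xs by (simp add: g_def gram_apply_def)
  have gu: "\<forall>j<k. ip d g (u j) = 0"
  proof (intro allI impI)
    fix j assume j: "j < k"
    have "ip d (gram_apply d X x) (u j) = (s j)\<^sup>2 * ip d x (u j)"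
      using eig j by (subst ip_gram_apply_commute) (simp add: ip_scale_left ip_commute)
    then show "ip d g (u j) = 0"
      using xs j by (simp add: g_def ip_diff_left ip_scale_left)
  qed
  have gx: "ip d x g = 0"
    using xs by (simp add: g_def ip_diff_right ip_scale_right m_def ip_commute[of d x "gram_apply d X x"] ip_gram_apply_self)
  have gg: "ip d (gram_apply d X x) g = ip d g g"
    using gx by (simp add: g_def ip_diff_left ip_scale_left)
  have "ip d g g = 0"
  proof (rule quadratic_vertex_zero)
    fix t :: real
    have "Xnorm2 d X (\<lambda>l. x l + t * g l) \<le> m * ip d (\<lambda>l. x l + t * g l) (\<lambda>l. x l + t * g l)"
      using xs g0 gu by (intro max) (auto simp: ip_add_left ip_scale_left)
    also have "ip d (\<lambda>l. x l + t * g l) (\<lambda>l. x l + t * g l) = 1 + t\<^sup>2 * ip d g g"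
      using xs gx by (simp add: ip_add_left ip_add_right ip_scale_left ip_scale_right ip_commute[of d g x] power2_eq_square)
    finally show "2 * t * ip d g g \<le> t\<^sup>2 * (m * ip d g g - Xnorm2 d X g)"
      unfolding Xnorm2_add gg m_def[symmetric] by (simp add: algebra_simps)
  qed
  then have "gram_apply d X x = (\<lambda>l. (sqrt m)\<^sup>2 * x l)"
    using g0 Xnorm2_nonneg[of d X x] unfolding ip_self_eq_0 g_def m_def
    by (auto simp: fun_eq_iff not_less[symmetric])
  moreover have "\<forall>w\<in>unit_sphere_d d. (\<forall>i<k. ip d w (u i) = 0) \<longrightarrow> Xnorm2 d X w \<le> (sqrt m)\<^sup>2"
    using x(2) Xnorm2_nonneg[of d X x] by (auto simp: W_def m_def ip_commute)
  ultimately show thesis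
    using that[of x "sqrt m"] xs x(1) Xnorm2_nonneg[of d X x] by (auto simp: W_def m_def)
qed

text \<open>The variational bound in the last clause is carried along because it makes the
  eigenvalues decrease: each later eigenvector is a competitor in every earlier
  maximization.\<close>

lemma greedy_eigenvectors:
  "k \<le> d \<Longrightarrow> \<exists>u s. orthonormal_family d k u \<and> (\<forall>j<k. 0 \<le> s j) \<and>
     (\<forall>j<k. gram_apply d X (u j) = (\<lambda>l. (s j)\<^sup>2 * u j l)) \<and>
     (\<forall>j<k. \<forall>w\<in>unit_sphere_d d. (\<forall>i<j. ip d w (u i) = 0) \<longrightarrow> Xnorm2 d X w \<le> (s j)\<^sup>2)"
proof (induction k)
  case 0
  then show ?case by (simp add: orthonormal_family_def)
next
  case (Suc k)
  then have "k < d" by simp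
  then obtain u s where us: "orthonormal_family d k u" "\<forall>j<k. 0 \<le> s j"
     "\<forall>j<k. gram_apply d X (u j) = (\<lambda>l. (s j)\<^sup>2 * u j l)"
     "\<forall>j<k. \<forall>w\<in>unit_sphere_d d. (\<forall>i<j. ip d w (u i) = 0) \<longrightarrow> Xnorm2 d X w \<le> (s j)\<^sup>2"
    using Suc.IH[OF less_imp_le] by blast
  obtain x \<mu> where x: "x \<in> unit_sphere_d d" "\<forall>j<k. ip d x (u j) = 0" "\<mu> \<ge> 0"
    "gram_apply d X x = (\<lambda>l. \<mu>\<^sup>2 * x l)"
    "\<forall>w\<in>unit_sphere_d d. (\<forall>i<k. ip d w (u i) = 0) \<longrightarrow> Xnorm2 d X w \<le> \<mu>\<^sup>2"
    using next_eigenvector[OF us(1) \<open>k < d\<close> us(3)] by blast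
  have "orthonormal_family d (Suc k) (u(k := x))"
    using us(1) x(1,2) by (auto simp: orthonormal_family_def less_Suc_eq ip_commute)
  then show ?case
    using us x
    by (intro exI[of _ "u(k := x)"] exI[of _ "s(k := \<mu>)"] conjI)
       (assumption | auto simp: less_Suc_eq)+
qed

lemma is_sv_seq_exists: "\<exists>s. is_sv_seq d X s"
proof -
  obtain u s where us: "orthonormal_family d d u" "\<forall>j<d. 0 \<le> s j"
     "\<forall>j<d. gram_apply d X (u j) = (\<lambda>l. (s j)\<^sup>2 * u j l)"
     "\<forall>j<d. \<forall>w\<in>unit_sphere_d d. (\<forall>i<j. ip d w (u i) = 0) \<longrightarrow> Xnorm2 d X w \<le> (s j)\<^sup>2"
    using greedy_eigenvectors[of d d X, OF order_refl] by (elim exE conjE)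
  have mono: "s k \<le> s j" if "j \<le> k" "k < d" for j k
  proof -
    have "Xnorm2 d X (u k) = (s k)\<^sup>2"
      using us(1,3) that by (simp add: ip_gram_apply_self[symmetric] ip_scale_left orthonormal_family_ip)
    moreover have "Xnorm2 d X (u k) \<le> (s j)\<^sup>2"
      using us(1,4) that by (auto simp: orthonormal_family_def)
    ultimately have "(s k)\<^sup>2 \<le> (s j)\<^sup>2" by linarith
    moreover have "0 \<le> s j" using us(2) that by simp
    ultimately show ?thesis by (rule power2_le_imp_le)
  qed
  define t where "t j = (if j < d then s j else 0)" for j
  have "is_sv_seq d X t"
    unfolding is_sv_seq_def
  proof (intro conjI exI[of _ u])
    show "\<forall>j k. j \<le> k \<longrightarrow> t k \<le> t j" using mono us(2) by (auto simp: t_def)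
  qed (use us in \<open>auto simp: t_def orthonormal_family_def ip_def\<close>)
  then show ?thesis by blast
qed

lemma is_sv_seq_singular_value: "is_sv_seq d X (singular_value d X)"
proof -
  obtain s where s: "is_sv_seq d X s" using is_sv_seq_exists by blast
  have "singular_value d X = s"
  proof -
    have "(THE s. is_sv_seq d X s) = s"
    proof (rule the_equality)
      fix t assume t: "is_sv_seq d X t"
      show "t = s"
        by (rule ext, rule antisym) (rule is_sv_seq_le[OF t s], rule is_sv_seq_le[OF s t])
    qed (rule s)
    then show ?thesis by (simp add: singular_value_def fun_eq_iff)
  qed
  then show ?thesis using s by simp
qed

section \<open>Estimates for the two largest singular values\<close>

lemma singular_value_nonneg: "singular_value d X k \<ge> 0"
  using is_sv_seq_singular_value by (auto simp: is_sv_seq_def)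

lemma Xnorm2_le_singular_value_0:
  assumes "w \<in> unit_sphere_d d"
  shows "Xnorm2 d X w \<le> (singular_value d X 0)\<^sup>2"
proof -
  note s = is_sv_seq_singular_value[of d X]
  obtain u where u: "orthonormal_family d d u"
    "\<forall>j<d. gram_apply d X (u j) = (\<lambda>l. (singular_value d X j)\<^sup>2 * u j l)"
    by (rule is_sv_seqE[OF s])
  have "Xnorm2 d X w \<le> (singular_value d X 0)\<^sup>2 * ip d w w"
    using s assms by (intro Xnorm2_upper[OF u]) (auto simp: is_sv_seq_def unit_sphere_d_iff)
  then show ?thesis using assms by (simp add: unit_sphere_d_iff)
qed

text \<open>The guarantee in \<open>top_sv_estimator\<close> is relative to a maximizer
  \<open>v\<close>, so one must be at hand to invoke it.\<close>

lemma top_singular_vector_exists: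
  assumes "d \<ge> 1"
  shows "\<exists>v\<in>unit_sphere_d d. \<forall>y\<in>unit_sphere_d d. Xnorm2 d X y \<le> Xnorm2 d X v"
proof -
  have "(\<lambda>l. if l = 0 then 1 else 0) \<in> unit_sphere_d d"
    using assms by (simp add: unit_sphere_d_def if_distrib[of "\<lambda>x. x\<^sup>2"] cong: if_cong)
  then have "unit_sphere_d d \<noteq> {}" by blast
  then show ?thesis
    using continuous_attains_sup[OF compact_unit_sphere_d _ continuous_on_Xnorm2] by blast
qed

text \<open>The plane of the two leading eigenvectors meets the hyperplane orthogonal to any
  \<open>v\<close> in a nonzero vector. The freedom in \<open>v\<close> allows an approximate
  singular vector, later the first row of the dataset.\<close>

lemma singular_value_1_le:
  assumes "d \<ge> 2" and b: "\<And>w. ip d w v = 0 \<Longrightarrow> Xnorm2 d X w \<le> b * ip d w w"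
  shows "(singular_value d X 1)\<^sup>2 \<le> b"
proof -
  note s = is_sv_seq_singular_value[of d X]
  obtain u where u: "orthonormal_family d d u"
    "\<forall>j<d. gram_apply d X (u j) = (\<lambda>l. (singular_value d X j)\<^sup>2 * u j l)"
    by (rule is_sv_seqE[OF s])
  have d: "1 < d" using assms by simp
  from span_meets_orthogonal_complement[OF u(1) d, of "\<lambda>_. v"]
  obtain w c where w: "w = (\<lambda>l. \<Sum>j\<le>1. c j * u j l)" "\<forall>i\<ge>d. w i = 0" "ip d w w > 0"
    "\<forall>j<(1::nat). ip d w v = 0" by blast
  have "(singular_value d X 1)\<^sup>2 * ip d w w \<le> Xnorm2 d X w"
    using s by (intro Xnorm2_lower[OF u(1) d u(2) _ _ w(1)]) (auto simp: is_sv_seq_def)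
  also have "\<dots> \<le> b * ip d w w" using w b by simp
  finally show ?thesis using w(3) by simp
qed

section \<open>A fingerprinting prior on column biases\<close>

text \<open>Extensional functions make this a finite set, and sums of products over it factor
  coordinate by coordinate.\<close>

definition sign_vecs :: "nat \<Rightarrow> (nat \<Rightarrow> real) set" where
  "sign_vecs n = PiE {..<n} (\<lambda>_. {-1, 1})"

text \<open>The probability of the sign \<open>v\<close> under the law on signs with mean
  \<open>p\<close>; \<open>col_wt\<close> is the law of n independent such signs.\<close>

definition sign_wt :: "real \<Rightarrow> real \<Rightarrow> real" where
  "sign_wt p v = (1 + v * p) / 2"

definition col_wt :: "nat \<Rightarrow> real \<Rightarrow> (nat \<Rightarrow> real) \<Rightarrow> real" where
  "col_wt n p c = (\<Prod>i<n. sign_wt p (c i))"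

definition col_score :: "nat \<Rightarrow> real \<Rightarrow> (nat \<Rightarrow> real) \<Rightarrow> real" where
  "col_score n p c = (\<Sum>i<n. c i - p)"

definition const_sign :: "nat \<Rightarrow> (nat \<Rightarrow> real) \<Rightarrow> real" where
  "const_sign n c = (if \<forall>i<n. c i = 1 then 1 else if \<forall>i<n. c i = -1 then -1 else 0)"

lemma finite_sign_vecs: "finite (sign_vecs n)"
  by (simp add: sign_vecs_def finite_PiE)

lemma card_sign_vecs: "card (sign_vecs n) = 2 ^ n"
  by (simp add: sign_vecs_def card_PiE numeral_2_eq_2)

lemma sign_vecs_D: "c \<in> sign_vecs n \<Longrightarrow> i < n \<Longrightarrow> c i = -1 \<or> c i = 1"
  by (auto simp: sign_vecs_def PiE_def Pi_def)

lemma sign_wt_nonneg: "\<bar>p\<bar> \<le> 1 \<Longrightarrow> v \<in> {-1, 1} \<Longrightarrow> sign_wt p v \<ge> 0"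
  by (auto simp: sign_wt_def abs_le_iff)

lemma sum_sign_wt: "(\<Sum>v\<in>{-1, 1}. sign_wt p v) = 1"
  by (simp add: sign_wt_def field_simps)

lemma col_wt_nonneg: "\<bar>p\<bar> \<le> 1 \<Longrightarrow> c \<in> sign_vecs n \<Longrightarrow> col_wt n p c \<ge> 0"
  unfolding col_wt_def by (intro prod_nonneg ballI sign_wt_nonneg) (auto dest: sign_vecs_D)

lemma sum_prod_sign_vecs:
  fixes f :: "nat \<Rightarrow> real \<Rightarrow> real"
  shows "(\<Sum>c\<in>sign_vecs n. \<Prod>i<n. f i (c i)) = (\<Prod>i<n. \<Sum>v\<in>{-1, 1}. f i v)"
  unfolding sign_vecs_def by (rule prod_sum_PiE[symmetric]) auto

lemma sum_col_wt: "(\<Sum>c\<in>sign_vecs n. col_wt n p c) = 1"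
  unfolding col_wt_def sum_prod_sign_vecs[of "\<lambda>_. sign_wt p" n] sum_sign_wt by simp

section \<open>The score as a derivative along a grid of biases\<close>

text \<open>On each grid cell the mean value theorem turns the increment of \<open>G\<close> into a
  value of \<open>g\<close>, which uniform continuity compares with the value at the left end; the
  increments telescope. Averages over finitely many biases thus obey the fundamental theorem of
  calculus up to any given error.\<close>

lemma riemann_sum_tendsto:
  fixes G g :: "real \<Rightarrow> real"
  assumes ab: "a < b" and G: "\<And>x. a \<le> x \<Longrightarrow> x \<le> b \<Longrightarrow> (G has_real_derivative g x) (at x)"
    and g: "continuous_on {a..b} g" and e: "e > 0"
  shows "\<forall>\<^sub>F K in sequentially. \<bar>(\<Sum>k<K. g (a + real k * (b - a) / real K)) / real K - (G b - G a) / (b - a)\<bar> \<le> e"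
proof -
  have "uniformly_continuous_on {a..b} g"
    using g by (intro compact_uniformly_continuous) auto
  then obtain \<delta> where \<delta>: "\<delta> > 0" "\<And>x y. x \<in> {a..b} \<Longrightarrow> y \<in> {a..b} \<Longrightarrow> \<bar>y - x\<bar> < \<delta> \<Longrightarrow> \<bar>g y - g x\<bar> < e"
    unfolding uniformly_continuous_on_def dist_real_def using e by metis
  show ?thesis
    using eventually_gt_at_top[of "nat \<lceil>(b - a) / \<delta>\<rceil>"]
  proof eventually_elim
    case (elim K)
    then have "(b - a) / \<delta> < real K" by linarith
    moreover have K: "K > 0" using elim by simp
    ultimately have h\<delta>: "(b - a) / real K < \<delta>" using \<delta>(1) by (simp add: field_simps)
    define h where "h = (b - a) / real K"
    define x where "x k = a + real k * h" for k
    have h: "h > 0" "h < \<delta>" using ab K h\<delta> by (auto simp: h_def)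
    have x0: "x 0 = a" and xK: "x K = b" using K by (auto simp: x_def h_def)
    have mem: "x k \<in> {a..b}" if "k \<le> K" for k
    proof -
      have "real k * h \<le> real K * h" using that h by (intro mult_right_mono) auto
      then show ?thesis using h xK by (auto simp: x_def)
    qed
    have step: "\<bar>h * g (x k) - (G (x (Suc k)) - G (x k))\<bar> \<le> h * e" if "k < K" for k
    proof -
      have xs: "x (Suc k) - x k = h" by (simp add: x_def algebra_simps)
      have lt: "x k < x (Suc k)" using xs h by simp
      have "\<exists>z. x k < z \<and> z < x (Suc k) \<and> G (x (Suc k)) - G (x k) = (x (Suc k) - x k) * g z"
        using mem[of k] mem[of "Suc k"] that by (intro MVT2[OF lt] G) auto
      then obtain z where z: "x k < z" "z < x (Suc k)" "G (x (Suc k)) - G (x k) = h * g z"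
        unfolding xs by blast
      have "\<bar>g (x k) - g z\<bar> < e"
        using mem[of k] mem[of "Suc k"] that z xs h by (intro \<delta>(2)) auto
      moreover have "h * g (x k) - h * g z = h * (g (x k) - g z)" by (simp add: algebra_simps)
      ultimately show ?thesis unfolding z(3) using h by (simp add: abs_mult)
    qed
    have tel: "(\<Sum>k<K. G (x (Suc k)) - G (x k)) = G b - G a"
      using sum_lessThan_telescope[of "\<lambda>k. G (x k)" K] x0 xK by simp
    have "\<bar>(\<Sum>k<K. h * g (x k)) - (G b - G a)\<bar> \<le> (\<Sum>k<K. h * e)"
      unfolding tel[symmetric] sum_subtractf[symmetric]
      by (rule order_trans[OF sum_abs]) (intro sum_mono step, simp)
    also have "(\<Sum>k<K. h * e) = (b - a) * e" using K by (simp add: h_def)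
    finally have le: "\<bar>(\<Sum>k<K. h * g (x k)) - (G b - G a)\<bar> \<le> (b - a) * e" .
    have "(\<Sum>k<K. g (x k)) / real K - (G b - G a) / (b - a) = ((\<Sum>k<K. h * g (x k)) - (G b - G a)) / (b - a)"
    proof -
      have "(\<Sum>k<K. g (x k)) / real K = (\<Sum>k<K. h * g (x k)) / (b - a)"
        unfolding sum_distrib_left[symmetric] using ab K by (simp add: h_def)
      then show ?thesis by (simp add: diff_divide_distrib)
    qed
    then have "\<bar>(\<Sum>k<K. g (x k)) / real K - (G b - G a) / (b - a)\<bar> \<le> e"
      using le ab by (simp add: abs_divide field_simps)
    then show ?case by (simp add: x_def h_def)
  qed
qed

text \<open>In the coordinate \<open>p = tanh \<theta>\<close> the fingerprinting score of a column is the logarithmic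
  derivative of its probability.\<close>

lemma DERIV_col_wt_tanh:
  assumes "c \<in> sign_vecs n"
  shows "((\<lambda>\<theta>. col_wt n (tanh \<theta>) c) has_real_derivative (col_wt n (tanh \<theta>) c * col_score n (tanh \<theta>) c)) (at \<theta>)"
proof -
  have cosh: "cosh \<theta> \<noteq> 0" by (rule cosh_real_nonzero)
  have 1: "((\<lambda>\<theta>. sign_wt (tanh \<theta>) (c i)) has_real_derivative
      sign_wt (tanh \<theta>) (c i) * (c i - tanh \<theta>)) (at \<theta>)" if "i < n" for i
  proof -
    have "((\<lambda>\<theta>. sign_wt (tanh \<theta>) (c i)) has_real_derivative (c i * (1 - (tanh \<theta>)\<^sup>2)) / 2) (at \<theta>)"
      unfolding sign_wt_def using cosh by (auto intro!: derivative_eq_intros)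
    moreover have "(c i * (1 - (tanh \<theta>)\<^sup>2)) / 2 = sign_wt (tanh \<theta>) (c i) * (c i - tanh \<theta>)"
      using sign_vecs_D[OF assms that] by (auto simp: sign_wt_def power2_eq_square field_simps)
    ultimately show ?thesis by simp
  qed
  have "((\<lambda>\<theta>. \<Prod>i<k. sign_wt (tanh \<theta>) (c i)) has_real_derivative
     (\<Prod>i<k. sign_wt (tanh \<theta>) (c i)) * (\<Sum>i<k. c i - tanh \<theta>)) (at \<theta>)" if "k \<le> n" for k
    using that
  proof (induction k)
    case (Suc k)
    have "((\<lambda>\<theta>. (\<Prod>i<k. sign_wt (tanh \<theta>) (c i)) * sign_wt (tanh \<theta>) (c k)) has_real_derivative
      (\<Prod>i<k. sign_wt (tanh \<theta>) (c i)) * (\<Sum>i<k. c i - tanh \<theta>) * sign_wt (tanh \<theta>) (c k)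
      + sign_wt (tanh \<theta>) (c k) * (c k - tanh \<theta>) * (\<Prod>i<k. sign_wt (tanh \<theta>) (c i))) (at \<theta>)"
      using Suc 1[of k] by (intro DERIV_mult) auto
    then show ?case by (simp add: algebra_simps)
  qed simp
  then show ?thesis unfolding col_wt_def col_score_def by blast
qed

lemma continuous_on_col_wt_tanh:
  "continuous_on S (\<lambda>\<theta>. col_wt n (tanh \<theta>) c * col_score n (tanh \<theta>) c)"
  unfolding col_wt_def col_score_def sign_wt_def
  by (intro continuous_intros) auto

lemma col_wt_unit_atom:
  assumes "c \<in> sign_vecs n" "p \<in> {-1, 1}" "col_wt n p c \<noteq> 0" "i < n"
  shows "c i = p"
proof -
  have "sign_wt p (c i) \<noteq> 0" using assms(3,4) by (auto simp: col_wt_def)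
  then show ?thesis using sign_vecs_D[OF assms(1,4)] assms(2) by (auto simp: sign_wt_def)
qed

text \<open>This fixes the length \<open>ln (100 * n)\<close> of the parameter interval: at its ends
  a single entry is wrong with probability 1 / (100 n + 1), so by Bernoulli's inequality the whole
  column is constant except with probability 1 / 100.\<close>

lemma col_wt_tanh_const:
  assumes n: "n \<ge> 1" and e: "e \<in> {-1, 1}"
  shows "col_wt n (tanh (e * ln (100 * real n) / 2)) (\<lambda>i\<in>{..<n}. e) \<ge> 99 / 100"
proof -
  define t where "t = ln (100 * real n) / 2"
  have N: "100 * real n > 0" using n by simp
  have "e * tanh (e * ln (100 * real n) / 2) = tanh t"
    using e by (auto simp: t_def)
  then have "sign_wt (tanh (e * ln (100 * real n) / 2)) e = (1 + tanh t) / 2"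
    by (simp add: sign_wt_def)
  also have "tanh t = (1 - exp (- 2 * t)) / (1 + exp (- 2 * t))" by (rule tanh_real_altdef)
  also have "exp (- 2 * t) = 1 / (100 * real n)"
    using N by (simp add: t_def exp_minus field_simps)
  also have "(1 + (1 - 1 / (100 * real n)) / (1 + 1 / (100 * real n))) / 2 = 1 + (- 1 / (100 * real n + 1))"
    using N by (simp add: divide_simps)
  finally have eq: "sign_wt (tanh (e * ln (100 * real n) / 2)) e = 1 + (- 1 / (100 * real n + 1))" .
  have "99 / 100 \<le> 1 + real n * (- 1 / (100 * real n + 1))"
    using N by (simp add: field_simps)
  also have "\<dots> \<le> (1 + (- 1 / (100 * real n + 1))) ^ n"
    using N by (intro Bernoulli_inequality) (auto simp: field_simps)
  finally show ?thesis by (simp add: col_wt_def eq)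
qed

lemma col_wt_atom:
  assumes "c \<in> sign_vecs n" "p \<in> {-1, 1}"
  shows "col_wt n p c = (if c = (\<lambda>i\<in>{..<n}. p) then 1 else 0)"
proof (cases "c = (\<lambda>i\<in>{..<n}. p)")
  case True
  then show ?thesis using assms by (auto simp: col_wt_def sign_wt_def)
next
  case False
  have "col_wt n p c = 0"
  proof (rule ccontr)
    assume "col_wt n p c \<noteq> 0"
    then have "c = (\<lambda>i\<in>{..<n}. p)"
      using col_wt_unit_atom[OF assms] assms(1) by (auto simp: sign_vecs_def PiE_def extensional_def fun_eq_iff)
    then show False using False by simp
  qed
  then show ?thesis using False by simp
qed

lemma const_sign_eq:
  assumes "c \<in> sign_vecs n" "n \<ge> 1"
  shows "const_sign n c = (if c = (\<lambda>i\<in>{..<n}. 1) then 1 else 0) - (if c = (\<lambda>i\<in>{..<n}. -1) then 1 else 0)"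
proof -
  have 1: "(\<forall>i<n. c i = a) \<longleftrightarrow> c = (\<lambda>i\<in>{..<n}. a)" for a
    using assms(1) by (auto simp: sign_vecs_def PiE_def extensional_def fun_eq_iff)
  have "(\<lambda>i\<in>{..<n}. 1 :: real) \<noteq> (\<lambda>i\<in>{..<n}. -1)"
    using assms(2) by (auto simp: fun_eq_iff intro!: exI[of _ 0])
  then show ?thesis by (auto simp: const_sign_def 1)
qed

text \<open>The mass missing at \<open>x\<close> equals the mass elsewhere, so the L1 distance
  counts it twice.\<close>

lemma near_point_mass:
  fixes w :: "'a \<Rightarrow> real"
  assumes "finite S" "\<And>c. c \<in> S \<Longrightarrow> w c \<ge> 0" "sum w S = 1" "x \<in> S" "w x \<ge> 1 - e"
  shows "(\<Sum>c\<in>S. \<bar>w c - (if c = x then 1 else 0)\<bar>) \<le> 2 * e"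
proof -
  have split: "sum h S = h x + sum h (S - {x})" for h :: "'a \<Rightarrow> real"
    using assms by (simp add: sum.remove)
  have "(\<Sum>c\<in>S - {x}. \<bar>w c - (if c = x then 1 else 0)\<bar>) = sum w (S - {x})"
    using assms(2) by (intro sum.cong) auto
  also have "\<dots> = 1 - w x" using split[of w] assms(3) by simp
  finally have "(\<Sum>c\<in>S. \<bar>w c - (if c = x then 1 else 0)\<bar>) = \<bar>w x - 1\<bar> + (1 - w x)"
    by (simp add: split[of "\<lambda>c. \<bar>w c - (if c = x then 1 else 0)\<bar>"])
  moreover have "w x \<le> 1"
    using split[of w] assms(2,3) sum_nonneg[of "S - {x}" w] by auto
  ultimately show ?thesis using assms(5) by simp
qed

text \<open>The last property says that, on average over columns, the posterior mean of the score is
  nearly \<open>2 * c0 * const_sign\<close>. Along the grid the averaged score telescopes to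
  \<open>\<eta> / T = c0\<close> times the difference of the column laws at the two ends, which are
  nearly the point masses at the constant columns. Each constant column has total probability about
  1 / 2, which explains the factor 2.\<close>

lemma fingerprinting_prior_exists:
  fixes \<eta> :: real
  assumes n: "n \<ge> 1" and \<eta>: "0 < \<eta>" "\<eta> \<le> 1 / 100" and c0: "c0 = \<eta> / ln (100 * real n)"
  shows "\<exists>(Q :: nat set) \<pi> pv. finite Q \<and> (\<forall>q\<in>Q. 0 \<le> \<pi> q \<and> \<bar>pv q\<bar> \<le> 1) \<and> sum \<pi> Q = 1 \<and>
    sum \<pi> {q\<in>Q. \<bar>pv q\<bar> < 1} \<le> \<eta> \<and>
    (\<Sum>c\<in>sign_vecs n. \<bar>\<Sum>q\<in>Q. \<pi> q * col_wt n (pv q) c * (col_score n (pv q) c - 2 * c0 * const_sign n c)\<bar>) \<le> c0 / 10"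
proof -
  define T where "T = ln (100 * real n)"
  have T: "T > 0" using n by (simp add: T_def)
  have c0T: "c0 = \<eta> / T" "c0 > 0" using c0 \<eta> T by (auto simp: T_def)
  define F where "F c \<theta> = col_wt n (tanh \<theta>) c" for c \<theta>
  define g where "g c \<theta> = col_wt n (tanh \<theta>) c * col_score n (tanh \<theta>) c" for c \<theta>
  \<comment> \<open>With this tolerance the Riemann error is \<open>c0 / (100 * 2 ^ n)\<close> per
    column, hence c0 / 100 over all 2 ^ n columns.\<close>
  define \<epsilon> where "\<epsilon> = 1 / (100 * T * 2 ^ n)"
  have \<epsilon>: "\<epsilon> > 0" using T by (simp add: \<epsilon>_def)
  define x where "x K k = - T / 2 + real k * T / real K" for K k
  have "\<forall>\<^sub>F K in sequentially. \<forall>c\<in>sign_vecs n.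
      \<bar>(\<Sum>k<K. g c (x K k)) / real K - (F c (T / 2) - F c (- T / 2)) / T\<bar> \<le> \<epsilon>"
  proof (intro eventually_ball_finite finite_sign_vecs ballI)
    fix c assume c: "c \<in> sign_vecs n"
    have "\<forall>\<^sub>F K in sequentially. \<bar>(\<Sum>k<K. g c (- T / 2 + real k * (T / 2 - - T / 2) / real K)) / real K
        - (F c (T / 2) - F c (- T / 2)) / (T / 2 - - T / 2)\<bar> \<le> \<epsilon>"
      unfolding F_def g_def using T \<epsilon>
      by (intro riemann_sum_tendsto DERIV_col_wt_tanh[OF c] continuous_on_col_wt_tanh) auto
    then show "\<forall>\<^sub>F K in sequentially. \<bar>(\<Sum>k<K. g c (x K k)) / real K - (F c (T / 2) - F c (- T / 2)) / T\<bar> \<le> \<epsilon>"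
      by (simp add: x_def)
  qed
  from eventually_happens[OF eventually_conj[OF this eventually_gt_at_top[of 0]]]
  obtain K where K: "K > 0" and RS: "\<And>c. c \<in> sign_vecs n \<Longrightarrow>
      \<bar>(\<Sum>k<K. g c (x K k)) / real K - (F c (T / 2) - F c (- T / 2)) / T\<bar> \<le> \<epsilon>"
    by auto
  \<comment> \<open>Indices below \<open>K\<close> are the grid biases and share the mass
    \<open>\<eta>\<close>; the index \<open>K\<close> is the bias 1 and \<open>Suc K\<close> the
    bias -1, and they share the rest equally.\<close>
  define Q where "Q = {..<Suc (Suc K)}"
  define pv where "pv k = (if k < K then tanh (x K k) else if k = K then 1 else -1)" for k
  define \<pi> where "\<pi> k = (if k < K then \<eta> / real K else (1 - \<eta>) / 2)" for k
  have sumQ: "sum h Q = (\<Sum>k<K. h k) + h K + h (Suc K)" for h :: "nat \<Rightarrow> real"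
    by (simp add: Q_def)
  have tanh1: "\<bar>tanh y\<bar> < 1" for y :: real
    using tanh_real_bounds[of y] by auto
  have nonneg: "\<forall>q\<in>Q. 0 \<le> \<pi> q \<and> \<bar>pv q\<bar> \<le> 1"
    using \<eta> tanh1 by (auto simp: \<pi>_def pv_def less_imp_le)
  have sum1: "sum \<pi> Q = 1"
    using K by (simp add: sumQ \<pi>_def field_simps)
  have "{q\<in>Q. \<bar>pv q\<bar> < 1} = {..<K}"
    using tanh1 by (auto simp: Q_def pv_def split: if_splits)
  then have act: "sum \<pi> {q\<in>Q. \<bar>pv q\<bar> < 1} \<le> \<eta>"
    using K by (simp add: \<pi>_def)
  define u where "u e = (\<lambda>i\<in>{..<n}. e :: real)" for e
  have u: "u e \<in> sign_vecs n" if "e \<in> {-1, 1}" for e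
    using that by (auto simp: u_def sign_vecs_def)
  have u_ne: "u 1 \<noteq> u (-1)"
    using n by (auto simp: u_def fun_eq_iff intro!: exI[of _ 0])
  define P where "P c = (\<Sum>q\<in>Q. \<pi> q * col_wt n (pv q) c)" for c
  have P_eq: "P c = (\<Sum>k<K. col_wt n (tanh (x K k)) c) * (\<eta> / real K)
      + (1 - \<eta>) / 2 * col_wt n 1 c + (1 - \<eta>) / 2 * col_wt n (-1) c" for c
    by (simp add: P_def sumQ \<pi>_def pv_def sum_divide_distrib sum_distrib_left mult.commute)
  \<comment> \<open>The two atoms alone give each constant column the probability (1 - \<eta>) / 2,
    and the grid adds at most \<eta>.\<close>
  have P_near: "\<bar>1 - 2 * P (u e)\<bar> \<le> \<eta>" if e: "e \<in> {-1, 1}" for e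
  proof -
    define A where "A = (\<Sum>k<K. col_wt n (tanh (x K k)) (u e))"
    have le1: "0 \<le> col_wt n (tanh y) (u e) \<and> col_wt n (tanh y) (u e) \<le> 1" for y
    proof
      show nn: "0 \<le> col_wt n (tanh y) (u e)"
        using tanh1[of y] by (intro col_wt_nonneg u[OF e]) simp
      show "col_wt n (tanh y) (u e) \<le> 1"
        unfolding sum_col_wt[of n "tanh y", symmetric]
        using tanh1[of y] by (intro member_le_sum u[OF e] finite_sign_vecs col_wt_nonneg) auto
    qed
    have A0: "0 \<le> A" unfolding A_def using le1 by (intro sum_nonneg) auto
    have "A \<le> (\<Sum>k<K. 1)" unfolding A_def using le1 by (intro sum_mono) auto
    then have "A * (\<eta> / real K) \<le> real K * (\<eta> / real K)" using \<eta> by (intro mult_right_mono) auto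
    then have A1: "A * (\<eta> / real K) \<le> \<eta>" using K by simp
    have A2: "0 \<le> A * (\<eta> / real K)" using A0 \<eta> by simp
    have "P (u e) = A * (\<eta> / real K) + (1 - \<eta>) / 2"
      using e u_ne u_ne[symmetric] by (auto simp: P_eq A_def col_wt_atom u u_def[symmetric])
    then show ?thesis using A1 A2 by argo
  qed
  have D_eq: "(\<Sum>q\<in>Q. \<pi> q * col_wt n (pv q) c * (col_score n (pv q) c - 2 * c0 * const_sign n c))
      = \<eta> * ((\<Sum>k<K. g c (x K k)) / real K) - 2 * c0 * const_sign n c * P c" if c: "c \<in> sign_vecs n" for c
  proof -
    \<comment> \<open>At bias 1 or -1 the only column of positive weight is constant and has score
      zero, so the score averages come from the grid alone.\<close>
    have atom: "col_wt n p c * col_score n p c = 0" if p: "p \<in> {-1, 1}" for p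
      using col_wt_unit_atom[OF c p] by (cases "col_wt n p c = 0") (simp_all add: col_score_def)
    have "(\<Sum>q\<in>Q. \<pi> q * (col_wt n (pv q) c * col_score n (pv q) c))
        = (\<Sum>k<K. \<eta> / real K * g c (x K k))"
      unfolding sumQ using atom[of 1] atom[of "-1"] by (auto simp: pv_def \<pi>_def g_def)
    then show ?thesis
      by (simp add: P_def right_diff_distrib sum_subtractf sum_distrib_left sum_divide_distrib mult_ac)
  qed
  have bound: "\<bar>\<Sum>q\<in>Q. \<pi> q * col_wt n (pv q) c * (col_score n (pv q) c - 2 * c0 * const_sign n c)\<bar>
      \<le> c0 / (100 * 2 ^ n) + c0 * \<bar>F c (T / 2) - (if c = u 1 then 1 else 0)\<bar>
        + c0 * \<bar>F c (- T / 2) - (if c = u (-1) then 1 else 0)\<bar>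
        + c0 * ((if c = u 1 then \<eta> else 0) + (if c = u (-1) then \<eta> else 0))"
    (is "\<bar>?D\<bar> \<le> ?a + c0 * \<bar>?b\<bar> + c0 * \<bar>?c\<bar> + c0 * ?d") if c: "c \<in> sign_vecs n" for c
  proof -
    define R where "R = (\<Sum>k<K. g c (x K k)) / real K - (F c (T / 2) - F c (- T / 2)) / T"
    have s: "const_sign n c = (if c = u 1 then 1 else 0) - (if c = u (-1) then 1 else 0)"
      using const_sign_eq[OF c n] by (simp add: u_def)
    have D: "?D = \<eta> * R + c0 * ?b + c0 * (- ?c) + c0 * (const_sign n c * (1 - 2 * P c))"
    proof -
      have "\<eta> * R = \<eta> * ((\<Sum>k<K. g c (x K k)) / real K) - c0 * (F c (T / 2) - F c (- T / 2))"
        by (simp add: R_def c0T(1) right_diff_distrib diff_divide_distrib)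
      then show ?thesis unfolding D_eq[OF c] by (simp add: s algebra_simps)
    qed
    have 1: "\<bar>\<eta> * R\<bar> \<le> ?a"
    proof -
      have "\<bar>\<eta> * R\<bar> \<le> \<eta> * \<epsilon>"
        using RS[OF c] \<eta> by (simp add: R_def abs_mult)
      also have "\<dots> = ?a" by (simp add: c0T \<epsilon>_def)
      finally show ?thesis .
    qed
    have 2: "\<bar>const_sign n c * (1 - 2 * P c)\<bar> \<le> ?d"
      using P_near[of 1] P_near[of "-1"] u_ne \<eta> by (auto simp: s)
    have "\<bar>c0 * (const_sign n c * (1 - 2 * P c))\<bar> \<le> c0 * ?d"
      unfolding abs_mult[of c0] using 2 c0T(2) by (simp add: abs_mult)
    moreover have "\<bar>c0 * ?b\<bar> = c0 * \<bar>?b\<bar>" "\<bar>c0 * (- ?c)\<bar> = c0 * \<bar>?c\<bar>"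
      using c0T(2) by (auto simp: abs_mult)
    ultimately show ?thesis unfolding D using 1 by linarith
  qed
  have Fb: "(\<Sum>c\<in>sign_vecs n. \<bar>F c (T / 2) - (if c = u 1 then 1 else 0)\<bar>) \<le> 2 * (1 / 100)"
    unfolding F_def using tanh1[of "T / 2"] col_wt_tanh_const[OF n, of 1]
    by (intro near_point_mass finite_sign_vecs col_wt_nonneg sum_col_wt u) (auto simp: u_def T_def)
  have Fa: "(\<Sum>c\<in>sign_vecs n. \<bar>F c (- T / 2) - (if c = u (-1) then 1 else 0)\<bar>) \<le> 2 * (1 / 100)"
    unfolding F_def using tanh1[of "T / 2"] col_wt_tanh_const[OF n, of "-1"]
    by (intro near_point_mass finite_sign_vecs col_wt_nonneg sum_col_wt u) (auto simp: u_def T_def)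
  have "(\<Sum>c\<in>sign_vecs n. \<bar>\<Sum>q\<in>Q. \<pi> q * col_wt n (pv q) c * (col_score n (pv q) c - 2 * c0 * const_sign n c)\<bar>)
    \<le> (\<Sum>c\<in>sign_vecs n. c0 / (100 * 2 ^ n) + c0 * \<bar>F c (T / 2) - (if c = u 1 then 1 else 0)\<bar>
        + c0 * \<bar>F c (- T / 2) - (if c = u (-1) then 1 else 0)\<bar>
        + c0 * ((if c = u 1 then \<eta> else 0) + (if c = u (-1) then \<eta> else 0)))"
    by (intro sum_mono bound)
  also have "\<dots> = c0 / 100 + c0 * (\<Sum>c\<in>sign_vecs n. \<bar>F c (T / 2) - (if c = u 1 then 1 else 0)\<bar>)
      + c0 * (\<Sum>c\<in>sign_vecs n. \<bar>F c (- T / 2) - (if c = u (-1) then 1 else 0)\<bar>) + c0 * (\<eta> + \<eta>)"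
    by (simp add: sum.distrib sum_distrib_left[symmetric] card_sign_vecs finite_sign_vecs u)
  \<comment> \<open>Error budget in units of c0 / 100: one for the Riemann sum, two for each end of
    the interval, one for each constant column whose probability deviates from 1 / 2. The total is
    7, below the required 10.\<close>
  also have "\<dots> \<le> c0 / 100 + c0 * (2 * (1 / 100)) + c0 * (2 * (1 / 100)) + c0 * (1 / 100 + 1 / 100)"
    using Fa Fb c0T(2) \<eta> by (intro add_mono mult_left_mono) auto
  also have "\<dots> \<le> c0 / 10" using c0T(2) by simp
  finally show ?thesis using nonneg sum1 act by (intro exI[of _ Q] exI[of _ \<pi>] exI[of _ pv]) (auto simp: Q_def)
qed

section \<open>Nearly rank-one datasets\<close>

definition embed_row :: "nat \<Rightarrow> (nat \<Rightarrow> real) \<Rightarrow> nat \<Rightarrow> real" where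
  "embed_row m r k = (if k = 0 then 1 / sqrt 2 else if k < Suc m then r (k - 1) / sqrt (2 * real m) else 0)"

definition embed_matrix :: "nat \<Rightarrow> nat \<Rightarrow> (nat \<Rightarrow> nat \<Rightarrow> real) \<Rightarrow> (nat \<Rightarrow> real) list" where
  "embed_matrix n m X = map (\<lambda>i. embed_row m (X i)) [0..<n]"

definition col :: "nat \<Rightarrow> (nat \<Rightarrow> nat \<Rightarrow> real) \<Rightarrow> nat \<Rightarrow> nat \<Rightarrow> real" where
  "col n X j = (\<lambda>i\<in>{..<n}. X i j)"

text \<open>Invariant under replacing \<open>y\<close> by \<open>-y\<close>: coordinate 0, which is
  positive in every embedded row, serves as the reference orientation. Matrix column
  \<open>j\<close> sits at coordinate \<open>Suc j\<close>.\<close>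

definition sign_answer :: "nat \<Rightarrow> (nat \<Rightarrow> real) \<Rightarrow> real" where
  "sign_answer j y = sgn (y 0) * sgn (y (Suc j))"

lemma length_embed_matrix [simp]: "length (embed_matrix n m X) = n"
  by (simp add: embed_matrix_def)

lemma nth_embed_matrix [simp]: "i < n \<Longrightarrow> embed_matrix n m X ! i = embed_row m (X i)"
  by (simp add: embed_matrix_def)

lemma ip_Suc: "ip (Suc m) u w = u 0 * w 0 + (\<Sum>j<m. u (Suc j) * w (Suc j))"
  unfolding ip_def by (rule sum.lessThan_Suc_shift)

lemma embed_row_in_sphere:
  assumes "r \<in> sign_vecs m" "m \<ge> 1"
  shows "embed_row m r \<in> unit_sphere_d (Suc m)"
proof -
  have "(\<Sum>j<m. embed_row m r (Suc j) * embed_row m r (Suc j)) = (\<Sum>j<m. 1 / (2 * real m))"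
  proof (rule sum.cong)
    fix j assume "j \<in> {..<m}"
    then have "r j * r j = 1" "j < m" using sign_vecs_D[OF assms(1), of j] by auto
    then show "embed_row m r (Suc j) * embed_row m r (Suc j) = 1 / (2 * real m)"
      by (simp add: embed_row_def)
  qed simp
  then show ?thesis
    using assms(2) by (simp add: unit_sphere_d_iff ip_Suc) (auto simp: embed_row_def)
qed

lemma embed_matrix_in_datasets:
  assumes "X \<in> PiE {..<n} (\<lambda>_. sign_vecs m)" "m \<ge> 1"
  shows "embed_matrix n m X \<in> datasets (Suc m) n"
  using assms PiE_mem[OF assms(1)] by (simp add: datasets_def embed_row_in_sphere)

lemma col_in_sign_vecs:
  assumes "X \<in> PiE {..<n} (\<lambda>_. sign_vecs m)" "j < m"
  shows "col n X j \<in> sign_vecs n"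
proof -
  have "X i j = -1 \<or> X i j = 1" if "i < n" for i
    using assms that sign_vecs_D[of "X i" m j] by (auto simp: PiE_def Pi_def)
  then show ?thesis by (auto simp: col_def sign_vecs_def)
qed

lemma abs_sign_answer: "\<bar>sign_answer j y\<bar> \<le> 1"
  by (simp add: sign_answer_def abs_mult abs_sgn_eq)

text \<open>The deterministic part of the argument. The choice of \<open>e\<close> makes the
  permitted loss \<open>lam * (4 * e) * n\<close>, at spectral ratio \<open>4 * e\<close>, a fixed
  small fraction 4 / 1000 of \<open>n\<close> whatever \<open>lam\<close> is.\<close>

locale few_nonconstant_columns =
  fixes n m :: nat and lam e :: real and X :: "nat \<Rightarrow> nat \<Rightarrow> real"
  assumes n: "n \<ge> 1" and m: "m \<ge> 1" and lam: "lam \<ge> 1" and e: "e = 1 / (1000 * lam)"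
    and X: "X \<in> PiE {..<n} (\<lambda>_. sign_vecs m)"
    and few: "real (card {j\<in>{..<m}. const_sign n (col n X j) = 0}) \<le> 2 * e\<^sup>2 * real m"
begin

abbreviation "D \<equiv> embed_matrix n m X"
text \<open>The embedded first row stands in for the top right singular vector.\<close>

abbreviation "u \<equiv> embed_row m (X 0)"
abbreviation "nonconst \<equiv> {j\<in>{..<m}. const_sign n (col n X j) = 0}"

lemma e_bounds: "0 < e" "e \<le> 1 / 1000" "lam * e = 1 / 1000" "e\<^sup>2 \<le> 1 / 1000000"
proof -
  show e0: "0 < e" and e1: "e \<le> 1 / 1000" and "lam * e = 1 / 1000"
    using lam by (auto simp: e field_simps)
  have "e\<^sup>2 \<le> (1 / 1000)\<^sup>2" using e0 e1 by (intro power_mono) auto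
  then show "e\<^sup>2 \<le> 1 / 1000000" by (simp add: power2_eq_square)
qed

lemma row: "i < n \<Longrightarrow> X i \<in> sign_vecs m"
  using PiE_mem[OF X] by simp

lemma u_sphere: "u \<in> unit_sphere_d (Suc m)"
  using row[of 0] n m by (simp add: embed_row_in_sphere)

lemma const_column: "j < m \<Longrightarrow> j \<notin> nonconst \<Longrightarrow> i < n \<Longrightarrow> X i j = const_sign n (col n X j)"
  by (cases "\<forall>i<n. X i j = 1"; cases "\<forall>i<n. X i j = -1") (simp_all add: const_sign_def col_def)

lemma sum_nonconst: "(\<Sum>j<m. if j \<in> nonconst then a else 0) = real (card nonconst) * a" for a :: real
proof -
  have "(\<Sum>j<m. if j \<in> nonconst then a else 0) = (\<Sum>j\<in>nonconst. a)"
    by (intro sum.mono_neutral_cong_right) auto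
  then show ?thesis by simp
qed

text \<open>Rows differ only in nonconstant columns, each contributing at most 4 / (2 m) to the
  squared distance, and there are at most \<open>2 * e^2 * m\<close> of them.\<close>

lemma row_dist:
  assumes i: "i < n"
  shows "ip (Suc m) (\<lambda>l. embed_row m (X i) l - u l) (\<lambda>l. embed_row m (X i) l - u l) \<le> 4 * e\<^sup>2"
proof -
  have "ip (Suc m) (\<lambda>l. embed_row m (X i) l - u l) (\<lambda>l. embed_row m (X i) l - u l)
      = (\<Sum>j<m. (X i j - X 0 j)\<^sup>2 / (2 * real m))"
    unfolding ip_Suc using m
    by (auto simp: embed_row_def diff_divide_distrib[symmetric] power2_eq_square intro!: sum.cong)
  also have "\<dots> \<le> (\<Sum>j<m. if j \<in> nonconst then 4 / (2 * real m) else 0)"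
  proof (rule sum_mono)
    fix j assume j: "j \<in> {..<m}"
    show "(X i j - X 0 j)\<^sup>2 / (2 * real m) \<le> (if j \<in> nonconst then 4 / (2 * real m) else 0)"
    proof (cases "j \<in> nonconst")
      case True
      have "(X i j - X 0 j)\<^sup>2 \<le> 4"
        using sign_vecs_D[OF row[OF i], of j] sign_vecs_D[OF row[of 0], of j] j n by auto
      then have "(X i j - X 0 j)\<^sup>2 / (2 * real m) \<le> 4 / (2 * real m)" by (intro divide_right_mono) auto
      then show ?thesis using True by (simp only: if_True)
    next
      case False
      then show ?thesis using const_column[of j i] const_column[of j 0] i j n by auto
    qed
  qed
  also have "\<dots> = real (card nonconst) * (4 / (2 * real m))"
    by (rule sum_nonconst)
  also have "\<dots> \<le> 2 * e\<^sup>2 * real m * (4 / (2 * real m))"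
    using few by (intro mult_right_mono) auto
  also have "\<dots> = 4 * e\<^sup>2" using m by simp
  finally show ?thesis .
qed

lemma row_ip_dist:
  assumes "i < n"
  shows "(ip (Suc m) (embed_row m (X i)) w - ip (Suc m) u w)\<^sup>2 \<le> 4 * e\<^sup>2 * ip (Suc m) w w"
proof -
  have "(ip (Suc m) (embed_row m (X i)) w - ip (Suc m) u w)\<^sup>2
      \<le> ip (Suc m) (\<lambda>l. embed_row m (X i) l - u l) (\<lambda>l. embed_row m (X i) l - u l) * ip (Suc m) w w"
    using ip_Cauchy_Schwarz[of "Suc m" "\<lambda>l. embed_row m (X i) l - u l" w] by (simp add: ip_diff_left)
  also have "\<dots> \<le> 4 * e\<^sup>2 * ip (Suc m) w w"
    by (rule mult_right_mono[OF row_dist[OF assms] ip_self_nonneg])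
  finally show ?thesis .
qed

text \<open>For unit vectors the inner product is 1 minus half the squared distance, so every row
  has inner product at least \<open>1 - 2 * e^2\<close> with \<open>u\<close>.\<close>

lemma Xnorm2_u: "Xnorm2 (Suc m) D u \<ge> real n * (1 - 2 * e\<^sup>2)\<^sup>2"
proof -
  have "(1 - 2 * e\<^sup>2)\<^sup>2 \<le> (ip (Suc m) (embed_row m (X i)) u)\<^sup>2" if i: "i < n" for i
  proof -
    have "ip (Suc m) u u = 1" "ip (Suc m) (embed_row m (X i)) (embed_row m (X i)) = 1"
      using u_sphere embed_row_in_sphere[OF row[OF i] m] by (auto simp: unit_sphere_d_iff)
    then have "2 - 2 * ip (Suc m) (embed_row m (X i)) u \<le> 4 * e\<^sup>2"
      using row_dist[OF i] by (simp add: ip_diff_left ip_diff_right ip_commute)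
    then show ?thesis using e_bounds(4) by (intro power_mono) auto
  qed
  then have "(\<Sum>i<n. (1 - 2 * e\<^sup>2)\<^sup>2) \<le> (\<Sum>i<n. (ip (Suc m) (embed_row m (X i)) u)\<^sup>2)"
    by (intro sum_mono) auto
  then show ?thesis by (simp add: Xnorm2_ip)
qed

text \<open>On the hyperplane orthogonal to \<open>u\<close> a row acts only through its difference
  from \<open>u\<close>, so the second singular value squared is at most \<open>4 * e^2 * n\<close>.
  Testing with \<open>u\<close> shows that the first one squared is at least n / 4.\<close>

lemma spectral_gap: "singular_value (Suc m) D 1 \<le> 4 * e * singular_value (Suc m) D 0"
proof -
  have "(singular_value (Suc m) D 1)\<^sup>2 \<le> real n * (4 * e\<^sup>2)"
  proof (rule singular_value_1_le)
    fix w assume w: "ip (Suc m) w u = 0"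
    have "Xnorm2 (Suc m) D w = (\<Sum>i<n. (ip (Suc m) (embed_row m (X i)) w - ip (Suc m) u w)\<^sup>2)"
      using w by (simp add: Xnorm2_ip ip_commute)
    also have "\<dots> \<le> (\<Sum>i<n. 4 * e\<^sup>2 * ip (Suc m) w w)"
      by (intro sum_mono row_ip_dist) auto
    finally show "Xnorm2 (Suc m) D w \<le> real n * (4 * e\<^sup>2) * ip (Suc m) w w" by simp
  qed (use m in simp)
  also have "\<dots> \<le> (4 * e)\<^sup>2 * (real n * (1 - 2 * e\<^sup>2)\<^sup>2)"
  proof -
    have "(1/2)\<^sup>2 \<le> (1 - 2 * e\<^sup>2)\<^sup>2" using e_bounds(4) by (intro power_mono) auto
    then have "1 \<le> 4 * (1 - 2 * e\<^sup>2)\<^sup>2" by (simp add: power2_eq_square)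
    then have "real n * (4 * e\<^sup>2) * 1 \<le> real n * (4 * e\<^sup>2) * (4 * (1 - 2 * e\<^sup>2)\<^sup>2)"
      by (intro mult_left_mono) auto
    then show ?thesis by (simp add: power_mult_distrib algebra_simps)
  qed
  also have "\<dots> \<le> (4 * e)\<^sup>2 * (singular_value (Suc m) D 0)\<^sup>2"
    using Xnorm2_u Xnorm2_le_singular_value_0[OF u_sphere, of D] by (intro mult_left_mono) auto
  finally have "(singular_value (Suc m) D 1)\<^sup>2 \<le> (4 * e * singular_value (Suc m) D 0)\<^sup>2"
    by (simp add: power_mult_distrib)
  then show ?thesis
    by (rule power2_le_imp_le) (use e_bounds(1) singular_value_nonneg in simp)
qed

text \<open>Otherwise every row would have inner product at most 0.99 + 2 e <= 0.992 with
  \<open>y\<close>. Since 0.992^2 < 0.999^2 - 0.004, the objective would fall short of its value at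
  \<open>u\<close> by more than the permitted loss.\<close>

lemma accurate_near_u:
  assumes y: "y \<in> unit_sphere_d (Suc m)"
    and acc: "Xnorm2 (Suc m) D y \<ge> Xnorm2 (Suc m) D u - lam * (4 * e) * real n"
  shows "\<bar>ip (Suc m) u y\<bar> \<ge> 99 / 100"
proof (rule ccontr)
  assume "\<not> ?thesis"
  then have r: "\<bar>ip (Suc m) u y\<bar> \<le> 99 / 100" by simp
  have "(ip (Suc m) (embed_row m (X i)) y)\<^sup>2 \<le> (992 / 1000)\<^sup>2" if i: "i < n" for i
  proof -
    have "(ip (Suc m) (embed_row m (X i)) y - ip (Suc m) u y)\<^sup>2 \<le> (2 * e)\<^sup>2"
      using row_ip_dist[OF i, of y] y by (simp add: unit_sphere_d_iff power_mult_distrib)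
    then have "\<bar>ip (Suc m) (embed_row m (X i)) y - ip (Suc m) u y\<bar> \<le> 2 * e"
      using e_bounds(1) abs_le_square_iff[of _ "2 * e"] by simp
    then have "\<bar>ip (Suc m) (embed_row m (X i)) y\<bar> \<le> 992 / 1000"
      using r e_bounds(2) by linarith
    then have "\<bar>ip (Suc m) (embed_row m (X i)) y\<bar>\<^sup>2 \<le> (992 / 1000)\<^sup>2" by (intro power_mono) auto
    then show ?thesis by simp
  qed
  then have "Xnorm2 (Suc m) D y \<le> (\<Sum>i<n. (992 / 1000)\<^sup>2)"
    unfolding Xnorm2_ip length_embed_matrix by (intro sum_mono) auto
  then have 1: "Xnorm2 (Suc m) D y \<le> real n * (992 / 1000)\<^sup>2" by simp
  have "(999 / 1000)\<^sup>2 \<le> (1 - 2 * e\<^sup>2)\<^sup>2" using e_bounds(4) by (intro power_mono) auto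
  then have "real n * (999 / 1000)\<^sup>2 \<le> real n * (1 - 2 * e\<^sup>2)\<^sup>2" by (intro mult_left_mono) auto
  moreover have "lam * (4 * e) * real n = real n * (4 / 1000)" using e_bounds(3) by simp
  ultimately have "real n * (999 / 1000)\<^sup>2 - real n * (4 / 1000) \<le> real n * (992 / 1000)\<^sup>2"
    using 1 acc Xnorm2_u by linarith
  then have "real n * ((999 / 1000)\<^sup>2 - 4 / 1000 - (992 / 1000)\<^sup>2) \<le> 0" by (simp add: algebra_simps)
  then show False using n by (simp add: power2_eq_square mult_le_0_iff)
qed

text \<open>After orienting \<open>y\<close> along \<open>u\<close>, their squared distance is at
  most 2 / 100. A column whose sign disagrees with the first row costs at least 1 / (2 m) of it, so
  agreement with the first row is at least 92 / 100 of m; nonconstant columns account for at most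
  another 2 / 100.\<close>

lemma accurate_correlation:
  assumes y: "y \<in> unit_sphere_d (Suc m)"
    and acc: "Xnorm2 (Suc m) D y \<ge> Xnorm2 (Suc m) D u - lam * (4 * e) * real n"
  shows "(\<Sum>j<m. sign_answer j y * const_sign n (col n X j)) \<ge> 9 / 10 * real m"
proof -
  define r where "r = ip (Suc m) u y"
  have r: "\<bar>r\<bar> \<ge> 99 / 100" unfolding r_def by (rule accurate_near_u[OF y acc])
  define z where "z = (\<lambda>l. sgn r * y l)"
  have "sgn r * sgn r = 1" using r by (auto simp: sgn_real_def)
  then have "ip (Suc m) z z = 1"
    using y by (simp add: z_def ip_scale_left ip_scale_right unit_sphere_d_iff mult.assoc[symmetric])
  moreover have "ip (Suc m) u z = \<bar>r\<bar>"
    by (simp add: z_def ip_scale_right r_def[symmetric] abs_sgn mult.commute)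
  ultimately have "ip (Suc m) (\<lambda>l. z l - u l) (\<lambda>l. z l - u l) = 2 - 2 * \<bar>r\<bar>"
    using u_sphere by (simp add: ip_diff_left ip_diff_right unit_sphere_d_iff ip_commute[of _ z u])
  then have dist: "(z 0 - u 0) * (z 0 - u 0) + (\<Sum>j<m. (z (Suc j) - u (Suc j)) * (z (Suc j) - u (Suc j))) \<le> 2 / 100"
    unfolding ip_Suc using r by linarith
  have nn: "(\<Sum>j<m. (z (Suc j) - u (Suc j)) * (z (Suc j) - u (Suc j))) \<ge> 0" by (intro sum_nonneg) auto
  \<comment> \<open>A nonpositive \<open>z 0\<close> would alone contribute 1 / 2 to the squared
    distance. Hence the sign of \<open>y 0\<close> reveals the correct orientation, as
    \<open>sign_answer\<close> presumes.\<close>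
  have "z 0 > 0"
  proof (rule ccontr)
    assume "\<not> z 0 > 0"
    then have "(1 / sqrt 2)\<^sup>2 \<le> (u 0 - z 0)\<^sup>2" by (intro power_mono) (auto simp: embed_row_def)
    then have "1 / 2 \<le> (z 0 - u 0) * (z 0 - u 0)" by (simp add: power2_eq_square algebra_simps)
    then show False using dist nn by linarith
  qed
  then have sgn0: "sgn (y 0) = sgn r" by (auto simp: z_def sgn_real_def zero_less_mult_iff split: if_splits)
  have ans: "sign_answer j y = sgn (z (Suc j))" for j
    by (simp add: sign_answer_def z_def sgn0 sgn_mult)
  \<comment> \<open>A wrong or zero sign lowers the right side to -1 or 0, while its squared
    distance of at least 1 / (2 m), multiplied by 4 m, lowers the left side to at most -1.\<close>
  have key: "1 - 4 * real m * ((z (Suc j) - u (Suc j)) * (z (Suc j) - u (Suc j))) \<le> sgn (z (Suc j)) * X 0 j"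
    if j: "j < m" for j
  proof -
    define s where "s = X 0 j"
    define a where "a = 1 / sqrt (2 * real m)"
    have s: "s = -1 \<or> s = 1" using sign_vecs_D[OF row[of 0] j] n by (simp add: s_def)
    have uj: "u (Suc j) = s * a" using j by (simp add: embed_row_def s_def a_def)
    have a: "a > 0" "4 * real m * a\<^sup>2 = 2" using m by (auto simp: a_def power_divide)
    have m0: "real m \<ge> 0" by simp
    show ?thesis
    proof (cases "z (Suc j) * s > 0")
      case True
      then have "sgn (z (Suc j)) * s = 1" using s by (auto simp: sgn_real_def)
      then show ?thesis using m0 by (simp add: s_def)
    next
      case False
      then have "a\<^sup>2 \<le> (a - z (Suc j) * s)\<^sup>2" using a(1) by (intro power_mono) auto
      also have "\<dots> = (z (Suc j) - u (Suc j)) * (z (Suc j) - u (Suc j))"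
        using s by (auto simp: uj power2_eq_square algebra_simps)
      finally have "4 * real m * a\<^sup>2 \<le> 4 * real m * ((z (Suc j) - u (Suc j)) * (z (Suc j) - u (Suc j)))"
        by (intro mult_left_mono) auto
      moreover have "sgn (z (Suc j)) * s \<ge> -1" using s by (auto simp: sgn_real_def)
      ultimately show ?thesis using a(2) by (simp add: s_def)
    qed
  qed
  have "(\<Sum>j<m. 1 - 4 * real m * ((z (Suc j) - u (Suc j)) * (z (Suc j) - u (Suc j))))
      \<le> (\<Sum>j<m. sgn (z (Suc j)) * X 0 j)"
    by (intro sum_mono key) auto
  moreover have "(\<Sum>j<m. 1 - 4 * real m * ((z (Suc j) - u (Suc j)) * (z (Suc j) - u (Suc j))))
      = real m - 4 * real m * (\<Sum>j<m. (z (Suc j) - u (Suc j)) * (z (Suc j) - u (Suc j)))"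
    by (simp add: sum_subtractf sum_distrib_left)
  moreover have "4 * real m * (\<Sum>j<m. (z (Suc j) - u (Suc j)) * (z (Suc j) - u (Suc j))) \<le> 4 * real m * (2 / 100)"
    using dist zero_le_square[of "z 0 - u 0"] by (intro mult_left_mono) linarith+
  ultimately have 1: "92 / 100 * real m \<le> (\<Sum>j<m. sgn (z (Suc j)) * X 0 j)" by linarith
  have "(\<Sum>j<m. sgn (z (Suc j)) * X 0 j) \<le> (\<Sum>j<m. sign_answer j y * const_sign n (col n X j) + (if j \<in> nonconst then 1 else 0))"
  proof (rule sum_mono)
    fix j assume j: "j \<in> {..<m}"
    show "sgn (z (Suc j)) * X 0 j \<le> sign_answer j y * const_sign n (col n X j) + (if j \<in> nonconst then 1 else 0)"
    proof (cases "j \<in> nonconst")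
      case True
      then show ?thesis using sign_vecs_D[OF row[of 0], of j] j n by (auto simp: sgn_real_def)
    next
      case False
      then show ?thesis using const_column[of j 0] j n by (simp add: ans)
    qed
  qed
  also have "\<dots> = (\<Sum>j<m. sign_answer j y * const_sign n (col n X j)) + real (card nonconst)"
    unfolding sum.distrib sum_nonconst by simp
  also have "real (card nonconst) \<le> 2 / 100 * real m"
    using few mult_right_mono[of "2 * e\<^sup>2" "2 / 100" "real m"] e_bounds(4) by linarith
  finally show ?thesis using 1 by linarith
qed

end

section \<open>Weights of rows and matrices\<close>

lemma exp_le_quadratic:
  fixes x :: real
  assumes "\<bar>x\<bar> \<le> 1"
  shows "exp x \<le> 1 + x + x\<^sup>2"
proof (cases "x \<ge> 0")
  case True
  then show ?thesis using exp_bound[of x] assms by simp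
next
  case False
  define y where "y = - x"
  have y: "0 < y" "y \<le> 1" using False assms by (auto simp: y_def)
  have "1 + y \<le> exp y" by (rule exp_ge_add_one_self)
  then have "exp (- y) \<le> 1 / (1 + y)" using y by (simp add: exp_minus field_simps)
  also have "\<dots> \<le> 1 - y + y\<^sup>2"
  proof -
    have "1 \<le> (1 - y + y\<^sup>2) * (1 + y)" using y by (simp add: algebra_simps power2_eq_square)
    then show ?thesis using y by (simp add: divide_le_eq)
  qed
  finally show ?thesis by (simp add: y_def)
qed

text \<open>Exchanges a finite weighted sum with the expectation under \<open>N\<close>, so that it
  is enough to bound the weighted indicators for each outcome. In the applications the outcome is
  the mechanism's answer, held fixed while biases or rows vary.\<close>

lemma weighted_measure_le:
  fixes a :: "'b \<Rightarrow> real"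
  assumes "prob_space N" "finite S" "\<And>s. s \<in> S \<Longrightarrow> E s \<in> sets N"
    and le: "\<And>y. (\<Sum>s\<in>S. a s * indicator (E s) y) \<le> B"
  shows "(\<Sum>s\<in>S. a s * measure N (E s)) \<le> B"
proof -
  interpret prob_space N by fact
  have int: "integrable N (\<lambda>y. a s * indicator (E s) y)" if "s \<in> S" for s
    using assms(3)[OF that] by (intro integrable_mult_right integrable_real_indicator) (auto simp: emeasure_eq_measure)
  have "(\<Sum>s\<in>S. a s * measure N (E s)) = (\<Sum>s\<in>S. \<integral>y. a s * indicator (E s) y \<partial>N)"
    using assms(3) by (intro sum.cong) (auto simp: sets.Int_space_eq2)
  also have "\<dots> = (\<integral>y. (\<Sum>s\<in>S. a s * indicator (E s) y) \<partial>N)"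
    using int by (rule Bochner_Integration.integral_sum[symmetric])
  also have "\<dots> \<le> (\<integral>y. B \<partial>N)"
    using int le by (intro integral_mono Bochner_Integration.integrable_sum) auto
  also have "\<dots> = B" by (simp add: prob_space)
  finally show ?thesis .
qed

section \<open>Random sign matrices by rows and by columns\<close>

definition matrices :: "nat \<Rightarrow> nat \<Rightarrow> (nat \<Rightarrow> nat \<Rightarrow> real) set" where
  "matrices n m = PiE {..<n} (\<lambda>_. sign_vecs m)"

lemma matrices_row: "X \<in> matrices n m \<Longrightarrow> i < n \<Longrightarrow> X i \<in> sign_vecs m"
  by (auto simp: matrices_def)

text \<open>Matrices are stored as functions of the row index, so transposition carries the sum to
  one whose outer index is the column, where it factors.\<close>

lemma sum_prod_columns:
  fixes B :: "nat \<Rightarrow> (nat \<Rightarrow> real) \<Rightarrow> real"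
  shows "(\<Sum>X\<in>matrices n m. \<Prod>j<m. B j (col n X j)) = (\<Prod>j<m. \<Sum>c\<in>sign_vecs n. B j c)"
proof -
  define tr where "tr n m X = (\<lambda>j\<in>{..<m}. col n X j)" for n m :: nat and X :: "nat \<Rightarrow> nat \<Rightarrow> real"
  have tr_mem: "tr n m X \<in> matrices m n" if "X \<in> matrices n m" for n m X
    using that col_in_sign_vecs unfolding tr_def matrices_def by (intro PiE_I) auto
  have tr_tr: "tr m n (tr n m X) = X" if "X \<in> matrices n m" for n m X
  proof (intro ext)
    fix i j
    have ext: "X i = undefined" if "\<not> i < n"
      using \<open>X \<in> matrices n m\<close> that by (auto simp: matrices_def PiE_def extensional_def)
    have ext2: "X i j = undefined" if "i < n" "\<not> j < m"
      using matrices_row[OF \<open>X \<in> matrices n m\<close> that(1)] that(2)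
      by (auto simp: sign_vecs_def PiE_def extensional_def)
    show "tr m n (tr n m X) i j = X i j"
      using ext ext2 by (cases "i < n"; cases "j < m") (auto simp: tr_def col_def)
  qed
  have "(\<Sum>X\<in>matrices n m. \<Prod>j<m. B j (col n X j)) = (\<Sum>Y\<in>matrices m n. \<Prod>j<m. B j (Y j))"
    by (rule sum.reindex_bij_witness[of _ "tr m n" "tr n m"])
       (use tr_mem tr_tr in \<open>auto simp: tr_def intro!: prod.cong\<close>)
  also have "\<dots> = (\<Prod>j<m. \<Sum>c\<in>sign_vecs n. B j c)"
    unfolding matrices_def by (rule prod_sum_PiE[symmetric]) (auto simp: finite_sign_vecs)
  finally show ?thesis .
qed

definition row_wt :: "nat \<Rightarrow> (nat \<Rightarrow> real) \<Rightarrow> (nat \<Rightarrow> real) \<Rightarrow> real" where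
  "row_wt m p r = (\<Prod>j<m. sign_wt (p j) (r j))"

definition mat_wt :: "nat \<Rightarrow> nat \<Rightarrow> (nat \<Rightarrow> real) \<Rightarrow> (nat \<Rightarrow> nat \<Rightarrow> real) \<Rightarrow> real" where
  "mat_wt n m p X = (\<Prod>i<n. row_wt m p (X i))"

lemma row_wt_nonneg: "(\<And>j. j < m \<Longrightarrow> \<bar>p j\<bar> \<le> 1) \<Longrightarrow> r \<in> sign_vecs m \<Longrightarrow> row_wt m p r \<ge> 0"
  unfolding row_wt_def by (intro prod_nonneg ballI sign_wt_nonneg) (auto dest: sign_vecs_D)

lemma mat_wt_nonneg: "(\<And>j. j < m \<Longrightarrow> \<bar>p j\<bar> \<le> 1) \<Longrightarrow> X \<in> matrices n m \<Longrightarrow> mat_wt n m p X \<ge> 0"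
  unfolding mat_wt_def by (intro prod_nonneg ballI row_wt_nonneg matrices_row) auto

lemma sum_row_wt: "(\<Sum>r\<in>sign_vecs m. row_wt m p r) = 1"
  unfolding row_wt_def sum_prod_sign_vecs[of "\<lambda>j. sign_wt (p j)" m] by (simp only: sum_sign_wt prod.neutral_const)

lemma sum_mat_wt: "(\<Sum>X\<in>matrices n m. mat_wt n m p X) = 1"
proof -
  have "(\<Sum>X\<in>matrices n m. mat_wt n m p X) = (\<Prod>i<n. \<Sum>r\<in>sign_vecs m. row_wt m p r)"
    unfolding matrices_def mat_wt_def by (rule prod_sum_PiE[symmetric]) (auto simp: finite_sign_vecs)
  then show ?thesis by (simp add: sum_row_wt)
qed

text \<open>The entries are independent given the biases. The privacy argument views the law by
  rows, the posterior argument by columns.\<close>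

lemma mat_wt_columns: "mat_wt n m p X = (\<Prod>j<m. col_wt n (p j) (col n X j))"
  unfolding mat_wt_def row_wt_def col_wt_def by (subst prod.swap) (simp add: col_def)

section \<open>Exponential moments of centered signs\<close>

text \<open>The exponential is expanded to second order; the linear term has mean zero and the
  deviation is at most 2. At bias 1 or -1 the sign is deterministic and has no deviation, so only
  biases strictly inside the interval contribute.\<close>

lemma two_point_mgf:
  assumes p: "\<bar>p\<bar> \<le> 1" and b: "\<bar>b\<bar> \<le> 1 / 2"
  shows "(\<Sum>v\<in>{-1, 1}. sign_wt p v * exp (b * (v - p))) \<le> (if \<bar>p\<bar> < 1 then exp (4 * b\<^sup>2) else 1)"
proof (cases "\<bar>p\<bar> < 1")
  case True
  have "(\<Sum>v\<in>{-1, 1}. sign_wt p v * exp (b * (v - p)))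
      \<le> (\<Sum>v\<in>{-1, 1}. sign_wt p v * (1 + b * (v - p) + 4 * b\<^sup>2))"
  proof (intro sum_mono mult_left_mono sign_wt_nonneg p)
    fix v :: real assume v: "v \<in> {-1, 1}"
    have vp: "\<bar>v - p\<bar> \<le> 2" using v p by auto
    have "\<bar>b\<bar> * \<bar>v - p\<bar> \<le> 1 / 2 * 2" using b vp by (intro mult_mono) auto
    then have "exp (b * (v - p)) \<le> 1 + b * (v - p) + (b * (v - p))\<^sup>2"
      by (intro exp_le_quadratic) (simp add: abs_mult)
    also have "(b * (v - p))\<^sup>2 \<le> 4 * b\<^sup>2"
    proof -
      have "\<bar>v - p\<bar>\<^sup>2 \<le> 2\<^sup>2" using vp by (intro power_mono) auto
      then have "b\<^sup>2 * (v - p)\<^sup>2 \<le> b\<^sup>2 * 4" by (intro mult_left_mono) auto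
      then show ?thesis by (simp add: power_mult_distrib)
    qed
    finally show "exp (b * (v - p)) \<le> 1 + b * (v - p) + 4 * b\<^sup>2" by simp
  qed
  also have "\<dots> = 1 + 4 * b\<^sup>2" by (simp add: sign_wt_def field_simps power2_eq_square)
  also have "\<dots> \<le> exp (4 * b\<^sup>2)" by (rule exp_ge_add_one_self)
  finally show ?thesis using True by simp
next
  case False
  then have "p = 1 \<or> p = -1" using p by auto
  then show ?thesis by (auto simp: sign_wt_def)
qed

text \<open>Chernoff bound with parameter \<open>b\<close> for answers \<open>f\<close> fixed
  independently of the row; the variance proxy counts only the columns that are truly
  random.\<close>

lemma fresh_row_tail:
  assumes p: "\<And>j. j < m \<Longrightarrow> \<bar>p j\<bar> \<le> 1" and f: "\<And>j. j < m \<Longrightarrow> \<bar>f j\<bar> \<le> 1"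
    and b: "0 \<le> b" "b \<le> 1 / 2"
  shows "(\<Sum>r\<in>sign_vecs m. row_wt m p r * (if t \<le> (\<Sum>j<m. f j * (r j - p j)) then 1 else 0))
    \<le> exp (4 * b\<^sup>2 * real (card {j\<in>{..<m}. \<bar>p j\<bar> < 1}) - b * t)"
proof -
  have "(\<Sum>r\<in>sign_vecs m. row_wt m p r * (if t \<le> (\<Sum>j<m. f j * (r j - p j)) then 1 else 0))
      \<le> (\<Sum>r\<in>sign_vecs m. row_wt m p r * exp (b * ((\<Sum>j<m. f j * (r j - p j)) - t)))"
    using b(1) by (intro sum_mono mult_left_mono row_wt_nonneg p) auto
  also have "\<dots> = (\<Sum>r\<in>sign_vecs m. exp (- b * t) * (\<Prod>j<m. sign_wt (p j) (r j) * exp (b * f j * (r j - p j))))"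
  proof (rule sum.cong)
    fix r
    have "exp (b * ((\<Sum>j<m. f j * (r j - p j)) - t)) = exp (- b * t + (\<Sum>j<m. b * f j * (r j - p j)))"
      by (simp add: right_diff_distrib sum_distrib_left mult.assoc)
    also have "\<dots> = exp (- b * t) * (\<Prod>j<m. exp (b * f j * (r j - p j)))"
      by (simp only: exp_add exp_sum finite_lessThan)
    finally show "row_wt m p r * exp (b * ((\<Sum>j<m. f j * (r j - p j)) - t))
        = exp (- b * t) * (\<Prod>j<m. sign_wt (p j) (r j) * exp (b * f j * (r j - p j)))"
      by (simp only: row_wt_def prod.distrib mult_ac)
  qed simp
  also have "\<dots> = exp (- b * t) * (\<Prod>j<m. \<Sum>v\<in>{-1, 1}. sign_wt (p j) v * exp (b * f j * (v - p j)))"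
    unfolding sum_distrib_left[symmetric]
    by (subst sum_prod_sign_vecs[of "\<lambda>j v. sign_wt (p j) v * exp (b * f j * (v - p j))"]) simp
  also have "(\<Prod>j<m. \<Sum>v\<in>{-1, 1}. sign_wt (p j) v * exp (b * f j * (v - p j)))
      \<le> (\<Prod>j<m. if \<bar>p j\<bar> < 1 then exp (4 * b\<^sup>2) else 1)"
  proof (rule prod_mono)
    fix j assume "j \<in> {..<m}"
    then have j: "j < m" by simp
    have bf: "\<bar>b * f j\<bar> \<le> b" using f[OF j] b mult_left_le[of "\<bar>f j\<bar>" b] by (simp add: abs_mult)
    have "(\<Sum>v\<in>{-1, 1}. sign_wt (p j) v * exp (b * f j * (v - p j)))
        \<le> (if \<bar>p j\<bar> < 1 then exp (4 * (b * f j)\<^sup>2) else 1)"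
      using bf b by (intro two_point_mgf p j) auto
    also have "\<dots> \<le> (if \<bar>p j\<bar> < 1 then exp (4 * b\<^sup>2) else 1)"
    proof -
      have "\<bar>b * f j\<bar>\<^sup>2 \<le> b\<^sup>2" using bf by (intro power_mono) auto
      then show ?thesis by simp
    qed
    finally show "0 \<le> (\<Sum>v\<in>{-1, 1}. sign_wt (p j) v * exp (b * f j * (v - p j))) \<and>
      (\<Sum>v\<in>{-1, 1}. sign_wt (p j) v * exp (b * f j * (v - p j))) \<le> (if \<bar>p j\<bar> < 1 then exp (4 * b\<^sup>2) else 1)"
      using p[OF j] by (intro conjI sum_nonneg mult_nonneg_nonneg sign_wt_nonneg) auto
  qed
  also have "(\<Prod>j<m. if \<bar>p j\<bar> < 1 then exp (4 * b\<^sup>2) else 1)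
      = exp (4 * b\<^sup>2) ^ card {j\<in>{..<m}. \<bar>p j\<bar> < 1}"
  proof -
    have "(\<Prod>j<m. if \<bar>p j\<bar> < 1 then exp (4 * b\<^sup>2) else 1) = (\<Prod>j\<in>{j\<in>{..<m}. \<bar>p j\<bar> < 1}. exp (4 * b\<^sup>2))"
      by (intro prod.mono_neutral_cong_right) auto
    then show ?thesis by simp
  qed
  also have "exp (- b * t) * exp (4 * b\<^sup>2) ^ card {j\<in>{..<m}. \<bar>p j\<bar> < 1}
      = exp (4 * b\<^sup>2 * real (card {j\<in>{..<m}. \<bar>p j\<bar> < 1}) - b * t)"
    by (simp add: exp_of_nat_mult[symmetric] exp_add[symmetric] mult.commute)
  finally show ?thesis by (simp add: mult_left_mono)
qed

text \<open>Exchanging row \<open>i\<close> with an independent fresh row is an involution that preserves the weights.\<close>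

lemma sum_swap_row:
  fixes \<Phi> :: "(nat \<Rightarrow> nat \<Rightarrow> real) \<Rightarrow> (nat \<Rightarrow> real) \<Rightarrow> real"
  assumes i: "i < n"
  shows "(\<Sum>X\<in>matrices n m. \<Sum>r\<in>sign_vecs m. mat_wt n m p X * row_wt m p r * \<Phi> (X(i := r)) (X i))
    = (\<Sum>X\<in>matrices n m. \<Sum>r\<in>sign_vecs m. mat_wt n m p X * row_wt m p r * \<Phi> X r)"
proof -
  have wt: "mat_wt n m p (X(i := r)) * row_wt m p (X i) = mat_wt n m p X * row_wt m p r" for X r
  proof -
    have "mat_wt n m p Y = row_wt m p (Y i) * (\<Prod>k\<in>{..<n} - {i}. row_wt m p (Y k))" for Y
      unfolding mat_wt_def using i by (subst prod.remove[of _ i]) auto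
    moreover have "(\<Prod>k\<in>{..<n} - {i}. row_wt m p ((X(i := r)) k)) = (\<Prod>k\<in>{..<n} - {i}. row_wt m p (X k))"
      by (intro prod.cong) auto
    ultimately show ?thesis by simp
  qed
  have "X(i := r) \<in> matrices n m" if "X \<in> matrices n m" "r \<in> sign_vecs m" for X r
    using that i unfolding matrices_def by (auto simp: PiE_def Pi_def extensional_def)
  then show ?thesis
    unfolding sum.cartesian_product
    by (intro sum.reindex_bij_witness[of _ "\<lambda>(X, r). (X(i := r), X i)" "\<lambda>(X, r). (X(i := r), X i)"])
       (use i wt in \<open>auto intro: matrices_row\<close>)
qed

section \<open>Tracing\<close>

locale fingerprinting_prior =
  fixes n m :: nat and \<eta> T c0 :: real and Q :: "nat set" and \<pi> pv :: "nat \<Rightarrow> real"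
  assumes n: "n \<ge> 1" and m: "m \<ge> 1" and \<eta>: "0 < \<eta>" "\<eta> \<le> 1 / 100"
    and T: "T = ln (100 * real n)" and c0: "c0 = \<eta> / T"
    and Q: "finite Q" and \<pi>_nonneg: "\<And>q. q \<in> Q \<Longrightarrow> 0 \<le> \<pi> q" and pv_le: "\<And>q. q \<in> Q \<Longrightarrow> \<bar>pv q\<bar> \<le> 1"
    and sum_\<pi>: "sum \<pi> Q = 1" and active: "sum \<pi> {q\<in>Q. \<bar>pv q\<bar> < 1} \<le> \<eta>"
    and bias: "(\<Sum>c\<in>sign_vecs n. \<bar>\<Sum>q\<in>Q. \<pi> q * col_wt n (pv q) c * (col_score n (pv q) c - 2 * c0 * const_sign n c)\<bar>) \<le> c0 / 10"
begin

text \<open>The parameter of the exponential moment. It is small enough for the quadratic expansion,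
  as \<open>\<alpha> * |R| <= 1\<close>, and makes the quadratic term \<alpha> * c0 / 10, the same
  size as the bias error.\<close>

definition "\<alpha> = 1 / (100 * (real n)\<^sup>2 * T)"
definition "R q c = col_score n (pv q) c - 2 * c0 * const_sign n c"
text \<open>Second-order bound for the exponential moment of one column over its random bias. The
  absolute value in the linear term makes it uniform over the answer sign, which may depend on the
  whole matrix.\<close>

definition "B c = (\<Sum>q\<in>Q. \<pi> q * col_wt n (pv q) c) + \<alpha> * \<bar>\<Sum>q\<in>Q. \<pi> q * col_wt n (pv q) c * R q c\<bar>
  + \<alpha>\<^sup>2 * (\<Sum>q\<in>Q. \<pi> q * col_wt n (pv q) c * (R q c)\<^sup>2)"
definition "priors = PiE {..<m} (\<lambda>_. Q)"
definition "prior_wt P = (\<Prod>j<m. \<pi> (P j))"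
definition "bias_vec P j = pv (P j)"
definition "num_active P = card {j\<in>{..<m}. \<bar>bias_vec P j\<bar> < 1}"

lemma T_ge_1: "T \<ge> 1"
proof -
  have "exp 1 \<le> (3::real)" using exp_le by simp
  also have "3 \<le> 100 * real n" using n by simp
  finally show ?thesis using n by (simp add: T ln_ge_iff)
qed

lemma c0_bounds: "0 < c0" "c0 \<le> \<eta>"
  using T_ge_1 \<eta> by (auto simp: c0 field_simps)

lemma \<alpha>_bounds: "0 < \<alpha>" "\<alpha> * (3 * real n) \<le> 1" "\<alpha> * (10 * (real n)\<^sup>2 * \<eta>) = c0 / 10"
proof -
  show "0 < \<alpha>" using n T_ge_1 by (simp add: \<alpha>_def)
  have "3 * real n \<le> 100 * (real n)\<^sup>2 * T"
  proof -
    have "3 * real n \<le> 100 * (real n)\<^sup>2 * 1" using n by (simp add: power2_eq_square)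
    also have "\<dots> \<le> 100 * (real n)\<^sup>2 * T" using T_ge_1 by (intro mult_left_mono) auto
    finally show ?thesis .
  qed
  then show "\<alpha> * (3 * real n) \<le> 1" using n T_ge_1 by (simp add: \<alpha>_def field_simps)
  show "\<alpha> * (10 * (real n)\<^sup>2 * \<eta>) = c0 / 10" using n T_ge_1 by (simp add: \<alpha>_def c0 field_simps)
qed

lemma abs_const_sign: "\<bar>const_sign n c\<bar> \<le> 1"
  by (simp add: const_sign_def)

lemma R_le:
  assumes c: "c \<in> sign_vecs n" and q: "q \<in> Q"
  shows "\<bar>R q c\<bar> \<le> 3 * real n"
proof -
  have "\<bar>col_score n (pv q) c\<bar> \<le> (\<Sum>i<n. \<bar>c i - pv q\<bar>)"
    unfolding col_score_def by (rule sum_abs)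
  also have "\<dots> \<le> (\<Sum>i<n. 2)"
  proof (rule sum_mono)
    fix i assume "i \<in> {..<n}"
    then show "\<bar>c i - pv q\<bar> \<le> 2" using sign_vecs_D[OF c, of i] pv_le[OF q] by auto
  qed
  finally have 1: "\<bar>col_score n (pv q) c\<bar> \<le> 2 * real n" by simp
  have "\<bar>2 * c0 * const_sign n c\<bar> \<le> 2 * c0 * 1"
    using abs_const_sign[of c] c0_bounds(1) unfolding abs_mult by (intro mult_mono) auto
  also have "\<dots> \<le> real n" using c0_bounds \<eta> n by linarith
  finally show ?thesis using 1 by (simp add: R_def)
qed

lemma column_exp_moment:
  assumes c: "c \<in> sign_vecs n" and f: "\<bar>f\<bar> \<le> 1"
  shows "(\<Sum>q\<in>Q. \<pi> q * col_wt n (pv q) c * exp (- \<alpha> * f * R q c)) \<le> B c"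
proof -
  have w: "\<pi> q * col_wt n (pv q) c \<ge> 0" if "q \<in> Q" for q
    using that by (intro mult_nonneg_nonneg \<pi>_nonneg col_wt_nonneg pv_le c)
  have "exp (- \<alpha> * f * R q c) \<le> 1 - \<alpha> * f * R q c + \<alpha>\<^sup>2 * (R q c)\<^sup>2" if q: "q \<in> Q" for q
  proof -
    have "\<alpha> * \<bar>f\<bar> * \<bar>R q c\<bar> \<le> \<alpha> * 1 * (3 * real n)"
      using f R_le[OF c q] \<alpha>_bounds(1) by (intro mult_mono) auto
    then have "exp (- \<alpha> * f * R q c) \<le> 1 + - \<alpha> * f * R q c + (- \<alpha> * f * R q c)\<^sup>2"
      using order_trans[of _ _ 1] \<alpha>_bounds(1,2) by (intro exp_le_quadratic) (simp only: abs_mult abs_minus_cancel abs_of_pos mult_1_right)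
    moreover have "(- \<alpha> * f * R q c)\<^sup>2 \<le> \<alpha>\<^sup>2 * (R q c)\<^sup>2"
    proof -
      have "f\<^sup>2 \<le> 1" using f by (simp add: abs_square_le_1)
      then have "f\<^sup>2 * (\<alpha>\<^sup>2 * (R q c)\<^sup>2) \<le> 1 * (\<alpha>\<^sup>2 * (R q c)\<^sup>2)" by (intro mult_right_mono) auto
      then show ?thesis by (simp add: power_mult_distrib mult_ac)
    qed
    ultimately show ?thesis by simp
  qed
  then have "(\<Sum>q\<in>Q. \<pi> q * col_wt n (pv q) c * exp (- \<alpha> * f * R q c))
      \<le> (\<Sum>q\<in>Q. \<pi> q * col_wt n (pv q) c * (1 - \<alpha> * f * R q c + \<alpha>\<^sup>2 * (R q c)\<^sup>2))"
    using w by (intro sum_mono mult_left_mono)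
  also have "\<dots> = (\<Sum>q\<in>Q. \<pi> q * col_wt n (pv q) c) - \<alpha> * (f * (\<Sum>q\<in>Q. \<pi> q * col_wt n (pv q) c * R q c))
      + \<alpha>\<^sup>2 * (\<Sum>q\<in>Q. \<pi> q * col_wt n (pv q) c * (R q c)\<^sup>2)"
    unfolding sum_distrib_left sum_subtractf[symmetric] sum.distrib[symmetric]
    by (intro sum.cong refl) (simp add: algebra_simps)
  also have "\<dots> \<le> B c"
  proof -
    define z where "z = (\<Sum>q\<in>Q. \<pi> q * col_wt n (pv q) c * R q c)"
    have "\<bar>f * z\<bar> \<le> 1 * \<bar>z\<bar>" unfolding abs_mult using f by (intro mult_right_mono) auto
    then have "\<alpha> * (- (f * z)) \<le> \<alpha> * \<bar>z\<bar>" using \<alpha>_bounds(1) by (intro mult_left_mono) auto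
    then show ?thesis by (simp add: B_def z_def[symmetric])
  qed
  finally show ?thesis .
qed

text \<open>Biases strictly inside (-1, 1) have mass at most \<open>\<eta>\<close> and residuals at
  most 3 n. At the two atoms the score vanishes, leaving only the small term of size
  \<open>c0^2\<close>.\<close>

lemma second_moment: "(\<Sum>c\<in>sign_vecs n. \<Sum>q\<in>Q. \<pi> q * col_wt n (pv q) c * (R q c)\<^sup>2) \<le> 10 * (real n)\<^sup>2 * \<eta>"
proof -
  have per_q: "(\<Sum>c\<in>sign_vecs n. col_wt n (pv q) c * (R q c)\<^sup>2) \<le> (if \<bar>pv q\<bar> < 1 then 9 * (real n)\<^sup>2 else 0) + 4 * c0\<^sup>2"
    if q: "q \<in> Q" for q
  proof -
    have "(\<Sum>c\<in>sign_vecs n. col_wt n (pv q) c * (R q c)\<^sup>2)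
       \<le> (\<Sum>c\<in>sign_vecs n. col_wt n (pv q) c * ((if \<bar>pv q\<bar> < 1 then 9 * (real n)\<^sup>2 else 0) + 4 * c0\<^sup>2))"
    proof (rule sum_mono)
      fix c assume c: "c \<in> sign_vecs n"
      have w: "col_wt n (pv q) c \<ge> 0" by (rule col_wt_nonneg[OF pv_le[OF q] c])
      show "col_wt n (pv q) c * (R q c)\<^sup>2 \<le> col_wt n (pv q) c * ((if \<bar>pv q\<bar> < 1 then 9 * (real n)\<^sup>2 else 0) + 4 * c0\<^sup>2)"
      proof (cases "\<bar>pv q\<bar> < 1")
        case True
        have "\<bar>R q c\<bar>\<^sup>2 \<le> (3 * real n)\<^sup>2" using R_le[OF c q] by (intro power_mono) auto
        then have "(R q c)\<^sup>2 \<le> 9 * (real n)\<^sup>2 + 4 * c0\<^sup>2"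
          using zero_le_power2[of c0] unfolding power2_abs power_mult_distrib by (simp add: add_increasing2)
        then show ?thesis using True w by (simp add: mult_left_mono)
      next
        case False
        then have p: "pv q \<in> {-1, 1}" using pv_le[OF q] by auto
        show ?thesis
        proof (cases "col_wt n (pv q) c = 0")
          case nz: False
          have "col_score n (pv q) c = 0"
            using col_wt_unit_atom[OF c p nz] by (simp add: col_score_def)
          then have "(R q c)\<^sup>2 = 4 * c0\<^sup>2 * \<bar>const_sign n c\<bar>\<^sup>2" by (simp add: R_def power_mult_distrib)
          also have "\<dots> \<le> 4 * c0\<^sup>2 * 1"
            using abs_const_sign[of c] by (intro mult_left_mono) (auto simp: abs_square_le_1)
          finally show ?thesis using False w by (simp add: mult_left_mono)
        qed simp
      qed
    qed
    also have "\<dots> = (if \<bar>pv q\<bar> < 1 then 9 * (real n)\<^sup>2 else 0) + 4 * c0\<^sup>2"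
      unfolding sum_distrib_right[symmetric] sum_col_wt by simp
    finally show ?thesis .
  qed
  have "(\<Sum>c\<in>sign_vecs n. \<Sum>q\<in>Q. \<pi> q * col_wt n (pv q) c * (R q c)\<^sup>2)
      = (\<Sum>q\<in>Q. \<pi> q * (\<Sum>c\<in>sign_vecs n. col_wt n (pv q) c * (R q c)\<^sup>2))"
    by (subst sum.swap) (simp add: sum_distrib_left mult.assoc)
  also have "\<dots> \<le> (\<Sum>q\<in>Q. \<pi> q * ((if \<bar>pv q\<bar> < 1 then 9 * (real n)\<^sup>2 else 0) + 4 * c0\<^sup>2))"
    by (intro sum_mono mult_left_mono per_q \<pi>_nonneg)
  also have "\<dots> = (\<Sum>q\<in>{q\<in>Q. \<bar>pv q\<bar> < 1}. \<pi> q * (9 * (real n)\<^sup>2)) + sum \<pi> Q * (4 * c0\<^sup>2)"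
  proof -
    have "(\<Sum>q\<in>Q. \<pi> q * (if \<bar>pv q\<bar> < 1 then 9 * (real n)\<^sup>2 else 0)) = (\<Sum>q\<in>{q\<in>Q. \<bar>pv q\<bar> < 1}. \<pi> q * (9 * (real n)\<^sup>2))"
      using Q by (intro sum.mono_neutral_cong_right) auto
    then show ?thesis by (simp only: distrib_left sum.distrib sum_distrib_right)
  qed
  also have "\<dots> = sum \<pi> {q\<in>Q. \<bar>pv q\<bar> < 1} * (9 * (real n)\<^sup>2) + 4 * c0\<^sup>2"
    by (simp only: sum_distrib_right sum_\<pi> mult_1)
  also have "\<dots> \<le> \<eta> * (9 * (real n)\<^sup>2) + (real n)\<^sup>2 * \<eta>"
  proof (intro add_mono mult_right_mono active)
    have "4 * c0\<^sup>2 \<le> 4 * (\<eta> * (1 / 100))"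
      unfolding power2_eq_square using c0_bounds \<eta> by (intro mult_left_mono mult_mono) auto
    also have "\<dots> \<le> 1 * \<eta>" using \<eta> by simp
    also have "\<dots> \<le> (real n)\<^sup>2 * \<eta>" using n \<eta> by (intro mult_right_mono) auto
    finally show "4 * c0\<^sup>2 \<le> (real n)\<^sup>2 * \<eta>" .
  qed simp
  finally show ?thesis by (simp add: algebra_simps)
qed

text \<open>The constant terms sum to 1; \<open>bias\<close> and \<open>second_moment\<close>
  contribute \<alpha> * c0 / 10 each.\<close>

lemma sum_B: "(\<Sum>c\<in>sign_vecs n. B c) \<le> exp (2 / 10 * \<alpha> * c0)"
proof -
  have "(\<Sum>c\<in>sign_vecs n. \<Sum>q\<in>Q. \<pi> q * col_wt n (pv q) c) = 1"
    by (subst sum.swap) (simp add: sum_distrib_left[symmetric] sum_col_wt sum_\<pi>)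
  then have "(\<Sum>c\<in>sign_vecs n. B c) = 1 + \<alpha> * (\<Sum>c\<in>sign_vecs n. \<bar>\<Sum>q\<in>Q. \<pi> q * col_wt n (pv q) c * R q c\<bar>)
      + \<alpha>\<^sup>2 * (\<Sum>c\<in>sign_vecs n. \<Sum>q\<in>Q. \<pi> q * col_wt n (pv q) c * (R q c)\<^sup>2)"
    by (simp add: B_def sum.distrib sum_distrib_left[symmetric])
  also have "\<dots> \<le> 1 + \<alpha> * (c0 / 10) + \<alpha>\<^sup>2 * (10 * (real n)\<^sup>2 * \<eta>)"
    using bias second_moment \<alpha>_bounds(1) unfolding R_def by (intro add_mono mult_left_mono) auto
  also have "\<alpha>\<^sup>2 * (10 * (real n)\<^sup>2 * \<eta>) = \<alpha> * (c0 / 10)"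
    using \<alpha>_bounds(3) by (simp add: power2_eq_square mult.assoc)
  also have "1 + \<alpha> * (c0 / 10) + \<alpha> * (c0 / 10) = 1 + 2 / 10 * \<alpha> * c0" by simp
  also have "\<dots> \<le> exp (2 / 10 * \<alpha> * c0)" by (rule exp_ge_add_one_self)
  finally show ?thesis .
qed

lemma B_nonneg: "c \<in> sign_vecs n \<Longrightarrow> B c \<ge> 0"
  by (intro order_trans[OF _ column_exp_moment[of c 0]] sum_nonneg mult_nonneg_nonneg \<pi>_nonneg col_wt_nonneg pv_le) auto

section \<open>Independent random biases for all columns\<close>

lemma finite_priors: "finite priors"
  by (simp add: priors_def finite_PiE Q)

lemma priors_mem: "P \<in> priors \<Longrightarrow> j < m \<Longrightarrow> P j \<in> Q"
  by (auto simp: priors_def)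

lemma prior_wt_nonneg: "P \<in> priors \<Longrightarrow> prior_wt P \<ge> 0"
  unfolding prior_wt_def by (intro prod_nonneg ballI \<pi>_nonneg priors_mem) auto

lemma bias_vec_le: "P \<in> priors \<Longrightarrow> j < m \<Longrightarrow> \<bar>bias_vec P j\<bar> \<le> 1"
  unfolding bias_vec_def by (intro pv_le priors_mem)

lemma sum_prior_prod: "(\<Sum>P\<in>priors. \<Prod>j<m. g j (P j)) = (\<Prod>j<m. \<Sum>q\<in>Q. g j q)" for g :: "nat \<Rightarrow> nat \<Rightarrow> real"
  unfolding priors_def by (rule prod_sum_PiE[symmetric]) (auto simp: Q)

lemma sum_prior_wt: "(\<Sum>P\<in>priors. prior_wt P) = 1"
  unfolding prior_wt_def sum_prior_prod[of "\<lambda>_. \<pi>"] sum_\<pi> by simp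

lemma expected_num_active: "(\<Sum>P\<in>priors. prior_wt P * real (num_active P)) \<le> real m * \<eta>"
proof -
  have one: "(\<Sum>P\<in>priors. prior_wt P * g (P j)) = (\<Sum>q\<in>Q. \<pi> q * g q)" if j: "j < m" for j and g :: "nat \<Rightarrow> real"
  proof -
    have "prior_wt P * g (P j) = (\<Prod>i<m. \<pi> (P i) * (if i = j then g (P i) else 1))" for P
      using j by (simp add: prior_wt_def prod.distrib prod.delta)
    then have "(\<Sum>P\<in>priors. prior_wt P * g (P j)) = (\<Prod>i<m. \<Sum>q\<in>Q. \<pi> q * (if i = j then g q else 1))"
      by (simp add: sum_prior_prod[of "\<lambda>i q. \<pi> q * (if i = j then g q else 1)"])
    also have "\<dots> = (\<Prod>i<m. if i = j then (\<Sum>q\<in>Q. \<pi> q * g q) else 1)"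
      by (intro prod.cong) (auto simp: sum_\<pi>)
    finally show ?thesis using j by (simp add: prod.delta)
  qed
  have card: "real (num_active P) = (\<Sum>j<m. if \<bar>pv (P j)\<bar> < 1 then 1 else 0)" for P
  proof -
    have "(\<Sum>j<m. if \<bar>pv (P j)\<bar> < 1 then 1 else 0) = (\<Sum>j\<in>{j\<in>{..<m}. \<bar>pv (P j)\<bar> < 1}. 1 :: real)"
      by (intro sum.mono_neutral_cong_right) auto
    then show ?thesis by (simp add: num_active_def bias_vec_def)
  qed
  have "(\<Sum>P\<in>priors. prior_wt P * real (num_active P))
      = (\<Sum>j<m. \<Sum>P\<in>priors. prior_wt P * (if \<bar>pv (P j)\<bar> < 1 then 1 else 0))"
    unfolding card sum_distrib_left by (rule sum.swap)
  also have "\<dots> = (\<Sum>j<m. \<Sum>q\<in>Q. \<pi> q * (if \<bar>pv q\<bar> < 1 then 1 else 0))"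
    by (intro sum.cong refl one[of _ "\<lambda>q. if \<bar>pv q\<bar> < 1 then 1 else 0"]) simp
  also have "(\<Sum>q\<in>Q. \<pi> q * (if \<bar>pv q\<bar> < 1 then 1 else 0)) = sum \<pi> {q\<in>Q. \<bar>pv q\<bar> < 1}"
    using Q by (intro sum.mono_neutral_cong_right) auto
  also have "(\<Sum>j<m. sum \<pi> {q\<in>Q. \<bar>pv q\<bar> < 1}) \<le> (\<Sum>j<m. \<eta>)" by (intro sum_mono active)
  finally show ?thesis by simp
qed

definition "good_priors = {P\<in>priors. real (num_active P) \<le> 2 * \<eta> * real m}"

text \<open>Markov's inequality at twice the expected number of active columns.\<close>

lemma good_priors_mass: "(\<Sum>P\<in>good_priors. prior_wt P) \<ge> 1 / 2"
proof -
  have em: "0 < 2 * \<eta> * real m" using \<eta> m by simp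
  have "(\<Sum>P\<in>priors - good_priors. prior_wt P) * (2 * \<eta> * real m)
      = (\<Sum>P\<in>priors - good_priors. prior_wt P * (2 * \<eta> * real m))" by (rule sum_distrib_right)
  also have "\<dots> \<le> (\<Sum>P\<in>priors - good_priors. prior_wt P * real (num_active P))"
    by (intro sum_mono mult_left_mono prior_wt_nonneg) (auto simp: good_priors_def)
  also have "\<dots> \<le> (\<Sum>P\<in>priors. prior_wt P * real (num_active P))"
    by (intro sum_mono2 finite_priors mult_nonneg_nonneg prior_wt_nonneg) auto
  also have "\<dots> \<le> 1 / 2 * (2 * \<eta> * real m)" using expected_num_active by (simp add: mult.commute)
  finally have "(\<Sum>P\<in>priors - good_priors. prior_wt P) \<le> 1 / 2" using em by (simp only: mult_le_cancel_right_pos)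
  moreover have "(\<Sum>P\<in>priors. prior_wt P) = (\<Sum>P\<in>priors - good_priors. prior_wt P) + (\<Sum>P\<in>good_priors. prior_wt P)"
    by (rule sum.subset_diff) (auto simp: good_priors_def finite_priors)
  ultimately show ?thesis using sum_prior_wt by simp
qed

end

text \<open>The mechanism enters only through bounded measurable answers \<open>f j\<close>, one per
  column, and through privacy under replacement of one row of the sign matrix; \<open>dp\<close>
  includes replacing a row by itself.\<close>

locale traced_mechanism = fingerprinting_prior +
  fixes N :: "(nat \<Rightarrow> nat \<Rightarrow> real) \<Rightarrow> 'a measure" and M0 :: "'a measure"
    and f :: "nat \<Rightarrow> 'a \<Rightarrow> real" and \<beta> :: real
  assumes N: "\<And>X. X \<in> matrices n m \<Longrightarrow> prob_space (N X)" "\<And>X. X \<in> matrices n m \<Longrightarrow> sets (N X) = sets M0"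
    and f_meas [measurable]: "\<And>j. f j \<in> borel_measurable M0" and f_le: "\<And>j y. \<bar>f j y\<bar> \<le> 1"
    and dp: "\<And>X i r E. X \<in> matrices n m \<Longrightarrow> i < n \<Longrightarrow> r \<in> sign_vecs m \<Longrightarrow> E \<in> sets M0 \<Longrightarrow>
      measure (N X) E \<le> exp 1 * measure (N (X(i := r))) E + \<beta> / (4 * real n)"
begin

definition "correlated X = {y\<in>space M0. 9 / 10 * real m \<le> (\<Sum>j<m. f j y * const_sign n (col n X j))}"
text \<open>The prior predicts a score of about \<open>2 * c0\<close> times the agreement, thus at
  least 1.8 * c0 * m on \<open>correlated X\<close>. The threshold leaves a margin of 0.8 * c0 *
  m.\<close>

definition "low_score P X = {y\<in>space M0. (\<Sum>j<m. f j y * col_score n (bias_vec P j) (col n X j)) < c0 * real m}"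
text \<open>The threshold is a 1 / n share of the one in \<open>low_score\<close>: a score that is
  not low is a sum over n rows, so some row reaches its share.\<close>

definition "accuses P r = {y\<in>space M0. c0 * real m / real n \<le> (\<Sum>j<m. f j y * (r j - bias_vec P j))}"

lemma sets_events: "correlated X \<in> sets M0" "low_score P X \<in> sets M0" "accuses P r \<in> sets M0"
  unfolding correlated_def low_score_def accuses_def by measurable

text \<open>On the event, the sum of \<open>- \<alpha> * f j y * R\<close> over the columns is at
  least 0.8 * \<alpha> * c0 * m, so the exponential Markov inequality gains the factor
  \<open>K\<close>. The exponential moment factors over columns and costs at most exp (0.2 *
  \<alpha> * c0 * m) by \<open>sum_B\<close>.\<close>

lemma correlated_low_score_unlikely:
  "(\<Sum>P\<in>priors. prior_wt P * (\<Sum>X\<in>matrices n m. mat_wt n m (bias_vec P) X * measure (N X) (correlated X \<inter> low_score P X)))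
    \<le> exp (- (6 / 10) * \<alpha> * c0 * real m)"
proof -
  define K where "K = exp (- (8 / 10) * \<alpha> * c0 * real m)"
  \<comment> \<open>Once \<open>X\<close> is fixed, the output law \<open>N X\<close> does not
    depend on \<open>P\<close>. Hence \<open>y\<close> can be fixed first and the biases averaged
    afterwards, column by column.\<close>
  have per_X: "(\<Sum>P\<in>priors. prior_wt P * mat_wt n m (bias_vec P) X * measure (N X) (correlated X \<inter> low_score P X))
      \<le> K * (\<Prod>j<m. B (col n X j))" if X: "X \<in> matrices n m" for X
  proof (rule weighted_measure_le[OF N(1)[OF X] finite_priors])
    show "correlated X \<inter> low_score P X \<in> sets (N X)" for P
      using sets_events N(2)[OF X] by auto
    fix y
    have colX: "col n X j \<in> sign_vecs n" if "j < m" for j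
      using X that by (intro col_in_sign_vecs) (auto simp: matrices_def)
    have "(\<Sum>P\<in>priors. prior_wt P * mat_wt n m (bias_vec P) X * indicator (correlated X \<inter> low_score P X) y)
      \<le> (\<Sum>P\<in>priors. prior_wt P * mat_wt n m (bias_vec P) X * (K * exp (\<Sum>j<m. - \<alpha> * f j y * R (P j) (col n X j))))"
    proof (intro sum_mono mult_left_mono mult_nonneg_nonneg prior_wt_nonneg mat_wt_nonneg bias_vec_le X)
      fix P
      show "indicator (correlated X \<inter> low_score P X) y \<le> K * exp (\<Sum>j<m. - \<alpha> * f j y * R (P j) (col n X j))"
      proof (cases "y \<in> correlated X \<inter> low_score P X")
        case True
        define S where "S = (\<Sum>j<m. f j y * col_score n (bias_vec P j) (col n X j))"
        define C where "C = (\<Sum>j<m. f j y * const_sign n (col n X j))"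
        have "(\<Sum>j<m. - \<alpha> * f j y * R (P j) (col n X j)) = - \<alpha> * S + 2 * \<alpha> * c0 * C"
          unfolding S_def C_def sum_distrib_left sum.distrib[symmetric] R_def bias_vec_def
          by (intro sum.cong refl) (simp add: algebra_simps)
        moreover have "\<alpha> * S \<le> \<alpha> * (c0 * real m)"
          using True \<alpha>_bounds(1) by (intro mult_left_mono) (auto simp: low_score_def S_def)
        moreover have "2 * \<alpha> * c0 * (9 / 10 * real m) \<le> 2 * \<alpha> * c0 * C"
          using True \<alpha>_bounds(1) c0_bounds(1) by (intro mult_left_mono) (auto simp: correlated_def C_def)
        ultimately have "0 \<le> - (8 / 10) * \<alpha> * c0 * real m + (\<Sum>j<m. - \<alpha> * f j y * R (P j) (col n X j))" by argo
        then have "1 \<le> exp (- (8 / 10) * \<alpha> * c0 * real m + (\<Sum>j<m. - \<alpha> * f j y * R (P j) (col n X j)))"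
          by (simp only: one_le_exp_iff)
        then show ?thesis using True unfolding exp_add K_def by simp
      next
        case False
        then show ?thesis by (simp add: K_def)
      qed
    qed
    also have "\<dots> = K * (\<Sum>P\<in>priors. \<Prod>j<m. \<pi> (P j) * col_wt n (pv (P j)) (col n X j) * exp (- \<alpha> * f j y * R (P j) (col n X j)))"
      unfolding sum_distrib_left
      by (intro sum.cong refl)
         (simp add: prior_wt_def mat_wt_columns bias_vec_def exp_sum prod.distrib mult_ac)
    also have "\<dots> = K * (\<Prod>j<m. \<Sum>q\<in>Q. \<pi> q * col_wt n (pv q) (col n X j) * exp (- \<alpha> * f j y * R q (col n X j)))"
      by (subst sum_prior_prod[of "\<lambda>j q. \<pi> q * col_wt n (pv q) (col n X j) * exp (- \<alpha> * f j y * R q (col n X j))"]) simp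
    also have "\<dots> \<le> K * (\<Prod>j<m. B (col n X j))"
    proof (intro mult_left_mono prod_mono conjI column_exp_moment f_le colX)
      fix j assume "j \<in> {..<m}"
      then show "0 \<le> (\<Sum>q\<in>Q. \<pi> q * col_wt n (pv q) (col n X j) * exp (- \<alpha> * f j y * R q (col n X j)))"
        by (intro sum_nonneg mult_nonneg_nonneg \<pi>_nonneg col_wt_nonneg pv_le colX) auto
    qed (auto simp: K_def)
    finally show "(\<Sum>P\<in>priors. prior_wt P * mat_wt n m (bias_vec P) X * indicator (correlated X \<inter> low_score P X) y)
        \<le> K * (\<Prod>j<m. B (col n X j))" .
  qed
  have "(\<Sum>P\<in>priors. prior_wt P * (\<Sum>X\<in>matrices n m. mat_wt n m (bias_vec P) X * measure (N X) (correlated X \<inter> low_score P X)))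
      = (\<Sum>X\<in>matrices n m. \<Sum>P\<in>priors. prior_wt P * mat_wt n m (bias_vec P) X * measure (N X) (correlated X \<inter> low_score P X))"
    unfolding sum_distrib_left by (subst sum.swap) (simp add: mult.assoc)
  also have "\<dots> \<le> (\<Sum>X\<in>matrices n m. K * (\<Prod>j<m. B (col n X j)))"
    by (intro sum_mono per_X)
  also have "\<dots> = K * (\<Prod>j<m. \<Sum>c\<in>sign_vecs n. B c)"
    unfolding sum_distrib_left[symmetric] by (subst sum_prod_columns[of "\<lambda>_. B"]) simp
  also have "\<dots> \<le> K * (\<Prod>j<m. exp (2 / 10 * \<alpha> * c0))"
    by (intro mult_left_mono prod_mono conjI sum_B sum_nonneg B_nonneg) (auto simp: K_def)
  also have "\<dots> = exp (- (6 / 10) * \<alpha> * c0 * real m)"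
    by (simp add: K_def exp_of_nat_mult[symmetric] exp_add[symmetric] algebra_simps)
  finally show ?thesis .
qed

text \<open>Privacy replaces row \<open>i\<close> in the mechanism's input by a fresh row;
  exchanging the names of the two rows then makes the accused row independent of the answer, and
  \<open>fresh_row_tail\<close> applies.\<close>

lemma accusation_unlikely:
  assumes P: "P \<in> good_priors" and i: "i < n"
  shows "(\<Sum>X\<in>matrices n m. mat_wt n m (bias_vec P) X * measure (N X) (accuses P (X i)))
    \<le> exp 1 * exp (- (\<eta> * real m / (32 * (real n)\<^sup>2 * T\<^sup>2))) + \<beta> / (4 * real n)"
proof -
  define p where "p = bias_vec P"
  have Pp: "P \<in> priors" using P by (simp add: good_priors_def)
  have p: "\<bar>p j\<bar> \<le> 1" if "j < m" for j using bias_vec_le[OF Pp that] by (simp add: p_def)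
  define H where "H = exp (- (\<eta> * real m / (32 * (real n)\<^sup>2 * T\<^sup>2)))"
  \<comment> \<open>This \<open>b\<close> minimizes the exponent
    \<open>8 * b^2 * \<eta> * m - b * \<eta> * m / (n * T)\<close>, whose minimum is
    \<open>- \<eta> * m / (32 * n^2 * T^2)\<close>.\<close>
  define b where "b = 1 / (16 * real n * T)"
  have nT: "real n * T \<ge> 1"
    using mult_mono[of 1 "real n" 1 T] n T_ge_1 by simp
  have b: "0 \<le> b" "b \<le> 1 / 2" using n T_ge_1 nT by (auto simp: b_def field_simps)
  have upd: "X(i := r) \<in> matrices n m" if "X \<in> matrices n m" "r \<in> sign_vecs m" for X r
    using that i unfolding matrices_def by (auto simp: PiE_def Pi_def extensional_def)
  have fresh: "(\<Sum>r\<in>sign_vecs m. row_wt m p r * measure (N X) (accuses P r)) \<le> H" if X: "X \<in> matrices n m" for X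
  proof (rule weighted_measure_le[OF N(1)[OF X] finite_sign_vecs])
    show "accuses P r \<in> sets (N X)" for r using sets_events(3) N(2)[OF X] by simp
    fix y
    have "(\<Sum>r\<in>sign_vecs m. row_wt m p r * indicator (accuses P r) y)
       \<le> (\<Sum>r\<in>sign_vecs m. row_wt m p r * (if c0 * real m / real n \<le> (\<Sum>j<m. f j y * (r j - p j)) then 1 else 0))"
      by (intro sum_mono mult_left_mono row_wt_nonneg p) (auto simp: accuses_def p_def indicator_def)
    also have "\<dots> \<le> exp (4 * b\<^sup>2 * real (card {j\<in>{..<m}. \<bar>p j\<bar> < 1}) - b * (c0 * real m / real n))"
      by (intro fresh_row_tail p f_le b)
    also have "\<dots> \<le> exp (4 * b\<^sup>2 * (2 * \<eta> * real m) - b * (c0 * real m / real n))"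
    proof -
      have "4 * b\<^sup>2 * real (card {j\<in>{..<m}. \<bar>p j\<bar> < 1}) \<le> 4 * b\<^sup>2 * (2 * \<eta> * real m)"
        using P by (intro mult_left_mono) (auto simp: good_priors_def num_active_def p_def)
      then show ?thesis by simp
    qed
    also have "4 * b\<^sup>2 * (2 * \<eta> * real m) - b * (c0 * real m / real n) = - (\<eta> * real m / (32 * (real n)\<^sup>2 * T\<^sup>2))"
      using n T_ge_1 by (simp add: b_def c0 power_mult_distrib power_divide field_simps power2_eq_square)
    finally show "(\<Sum>r\<in>sign_vecs m. row_wt m p r * indicator (accuses P r) y) \<le> H" by (simp add: H_def)
  qed
  have "(\<Sum>X\<in>matrices n m. mat_wt n m p X * measure (N X) (accuses P (X i)))
      = (\<Sum>X\<in>matrices n m. \<Sum>r\<in>sign_vecs m. mat_wt n m p X * row_wt m p r * measure (N X) (accuses P (X i)))"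
  proof (rule sum.cong)
    fix X
    have "(\<Sum>r\<in>sign_vecs m. mat_wt n m p X * row_wt m p r * measure (N X) (accuses P (X i)))
        = mat_wt n m p X * measure (N X) (accuses P (X i)) * (\<Sum>r\<in>sign_vecs m. row_wt m p r)"
      unfolding sum_distrib_left by (intro sum.cong) auto
    then show "mat_wt n m p X * measure (N X) (accuses P (X i))
        = (\<Sum>r\<in>sign_vecs m. mat_wt n m p X * row_wt m p r * measure (N X) (accuses P (X i)))"
      by (simp add: sum_row_wt)
  qed simp
  also have "\<dots> \<le> (\<Sum>X\<in>matrices n m. \<Sum>r\<in>sign_vecs m. mat_wt n m p X * row_wt m p r *
      (exp 1 * measure (N (X(i := r))) (accuses P (X i)) + \<beta> / (4 * real n)))"
    by (intro sum_mono mult_left_mono mult_nonneg_nonneg mat_wt_nonneg row_wt_nonneg p dp i sets_events)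
  also have "\<dots> = (\<Sum>X\<in>matrices n m. \<Sum>r\<in>sign_vecs m. mat_wt n m p X * row_wt m p r *
      (exp 1 * measure (N X) (accuses P r) + \<beta> / (4 * real n)))"
    by (rule sum_swap_row[OF i, of m p "\<lambda>X r. exp 1 * measure (N X) (accuses P r) + \<beta> / (4 * real n)"])
  also have "\<dots> = (\<Sum>X\<in>matrices n m. mat_wt n m p X *
      (exp 1 * (\<Sum>r\<in>sign_vecs m. row_wt m p r * measure (N X) (accuses P r)) + \<beta> / (4 * real n) * (\<Sum>r\<in>sign_vecs m. row_wt m p r)))"
    unfolding sum_distrib_left sum.distrib[symmetric]
    by (intro sum.cong refl) (simp add: algebra_simps)
  also have "\<dots> \<le> (\<Sum>X\<in>matrices n m. mat_wt n m p X * (exp 1 * H + \<beta> / (4 * real n)))"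
    unfolding sum_row_wt using fresh
    by (intro sum_mono mult_left_mono mat_wt_nonneg p add_mono) auto
  also have "\<dots> = exp 1 * H + \<beta> / (4 * real n)"
    unfolding sum_distrib_right[symmetric] sum_mat_wt by simp
  finally show ?thesis by (simp add: p_def H_def)
qed

text \<open>For a suitable bias vector, the probability \<beta> of correlation is split into a low
  score, costing at most \<beta> / 4, and an accusation of one of the n rows. The additive privacy
  losses sum to another \<beta> / 4, which leaves \<beta> / 2 for the tails of the fresh
  rows.\<close>

lemma tracing_bound:
  assumes acc: "\<And>P X. P \<in> good_priors \<Longrightarrow> X \<in> matrices n m \<Longrightarrow> mat_wt n m (bias_vec P) X \<noteq> 0 \<Longrightarrow>
      \<beta> \<le> measure (N X) (correlated X)"
    and \<beta>: "exp (- (6 / 10) * \<alpha> * c0 * real m) < \<beta> / 8"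
  shows "\<beta> / 2 \<le> real n * (exp 1 * exp (- (\<eta> * real m / (32 * (real n)\<^sup>2 * T\<^sup>2))))"
proof -
  define bad where "bad P = (\<Sum>X\<in>matrices n m. mat_wt n m (bias_vec P) X * measure (N X) (correlated X \<inter> low_score P X))" for P
  have bad_nonneg: "0 \<le> bad P" if "P \<in> priors" for P
    unfolding bad_def using that by (intro sum_nonneg mult_nonneg_nonneg mat_wt_nonneg bias_vec_le) auto
  \<comment> \<open>Averaging: the prior-weighted total of \<open>bad\<close> is below \<beta> / 8
    while good priors have mass at least 1 / 2.\<close>
  have "\<exists>P\<in>good_priors. bad P \<le> \<beta> / 4"
  proof (rule ccontr)
    assume "\<not> ?thesis"
    then have gt: "\<beta> / 4 \<le> bad P" if "P \<in> good_priors" for P using that by force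
    have sub: "good_priors \<subseteq> priors" by (auto simp: good_priors_def)
    have \<beta>0: "\<beta> \<ge> 0" using \<beta> exp_gt_zero[of "- (6 / 10) * \<alpha> * c0 * real m"] by linarith
    have "\<beta> / 8 = 1 / 2 * (\<beta> / 4)" by simp
    also have "\<dots> \<le> (\<Sum>P\<in>good_priors. prior_wt P) * (\<beta> / 4)"
      using good_priors_mass \<beta>0 by (intro mult_right_mono) auto
    also have "\<dots> \<le> (\<Sum>P\<in>good_priors. prior_wt P * bad P)"
      unfolding sum_distrib_right using sub by (intro sum_mono mult_left_mono gt prior_wt_nonneg) auto
    also have "\<dots> \<le> (\<Sum>P\<in>priors. prior_wt P * bad P)"
      using sub by (intro sum_mono2 finite_priors mult_nonneg_nonneg prior_wt_nonneg bad_nonneg) auto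
    also have "\<dots> \<le> exp (- (6 / 10) * \<alpha> * c0 * real m)"
      unfolding bad_def by (rule correlated_low_score_unlikely)
    finally show False using \<beta> by linarith
  qed
  then obtain P where P: "P \<in> good_priors" "bad P \<le> \<beta> / 4" by blast
  define p where "p = bias_vec P"
  have Pp: "P \<in> priors" using P by (simp add: good_priors_def)
  have w: "mat_wt n m p X \<ge> 0" if "X \<in> matrices n m" for X
    unfolding p_def using that Pp by (intro mat_wt_nonneg bias_vec_le)
  have per_X: "mat_wt n m p X * \<beta> \<le> mat_wt n m p X * measure (N X) (correlated X \<inter> low_score P X)
      + (\<Sum>i<n. mat_wt n m p X * measure (N X) (accuses P (X i)))" if X: "X \<in> matrices n m" for X
  proof (cases "mat_wt n m p X = 0")
    case False
    interpret prob_space "N X" by (rule N(1)[OF X])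
    have sp: "space (N X) = space M0" using N(2)[OF X] by (rule sets_eq_imp_space_eq)
    have ev: "correlated X \<in> events" "low_score P X \<in> events" "accuses P r \<in> events" for r
      using sets_events N(2)[OF X] by auto
    \<comment> \<open>Pigeonhole: if no row reaches its share \<open>c0 * m / n\<close>, the total
      score stays below \<open>c0 * m\<close>.\<close>
    have "correlated X \<subseteq> (correlated X \<inter> low_score P X) \<union> (\<Union>i<n. accuses P (X i))"
    proof
      fix y assume y: "y \<in> correlated X"
      show "y \<in> (correlated X \<inter> low_score P X) \<union> (\<Union>i<n. accuses P (X i))"
      proof (rule ccontr)
        assume not: "\<not> ?thesis"
        have ys: "y \<in> space M0" using y by (simp add: correlated_def)
        have low: "c0 * real m \<le> (\<Sum>j<m. f j y * col_score n (p j) (col n X j))"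
          using not y ys by (auto simp: low_score_def p_def not_less)
        have "(\<Sum>j<m. f j y * col_score n (p j) (col n X j)) = (\<Sum>j<m. \<Sum>i<n. f j y * (X i j - p j))"
          by (intro sum.cong refl) (simp add: col_score_def col_def sum_distrib_left)
        also have "\<dots> = (\<Sum>i<n. \<Sum>j<m. f j y * (X i j - p j))" by (rule sum.swap)
        also have "\<dots> < (\<Sum>i<n. c0 * real m / real n)"
          using n not ys by (intro sum_strict_mono) (auto simp: accuses_def p_def not_le lessThan_empty_iff)
        also have "\<dots> = c0 * real m" using n by simp
        finally show False using low by simp
      qed
    qed
    then have "prob (correlated X) \<le> prob ((correlated X \<inter> low_score P X) \<union> (\<Union>i<n. accuses P (X i)))"
      using ev by (intro finite_measure_mono) auto
    also have "\<dots> \<le> prob (correlated X \<inter> low_score P X) + prob (\<Union>i<n. accuses P (X i))"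
      using ev by (intro measure_Un_le) auto
    also have "prob (\<Union>i<n. accuses P (X i)) \<le> (\<Sum>i<n. prob (accuses P (X i)))"
      using ev by (intro measure_UNION_le) auto
    finally have "\<beta> \<le> prob (correlated X \<inter> low_score P X) + (\<Sum>i<n. prob (accuses P (X i)))"
      using acc[OF P(1) X] False by (simp add: p_def)
    then have "mat_wt n m p X * \<beta> \<le> mat_wt n m p X * (prob (correlated X \<inter> low_score P X) + (\<Sum>i<n. prob (accuses P (X i))))"
      using w[OF X] by (intro mult_left_mono)
    then show ?thesis by (simp add: distrib_left sum_distrib_left)
  qed simp
  define H where "H = exp 1 * exp (- (\<eta> * real m / (32 * (real n)\<^sup>2 * T\<^sup>2)))"
  have "\<beta> = (\<Sum>X\<in>matrices n m. mat_wt n m p X * \<beta>)"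
    unfolding sum_distrib_right[symmetric] sum_mat_wt by simp
  also have "\<dots> \<le> (\<Sum>X\<in>matrices n m. mat_wt n m p X * measure (N X) (correlated X \<inter> low_score P X)
      + (\<Sum>i<n. mat_wt n m p X * measure (N X) (accuses P (X i))))"
    by (intro sum_mono per_X)
  also have "\<dots> = bad P + (\<Sum>i<n. \<Sum>X\<in>matrices n m. mat_wt n m p X * measure (N X) (accuses P (X i)))"
    unfolding sum.distrib bad_def p_def by (subst (2) sum.swap) simp
  also have "\<dots> \<le> \<beta> / 4 + (\<Sum>i<n. H + \<beta> / (4 * real n))"
    unfolding p_def H_def using accusation_unlikely[OF P(1)] by (intro add_mono P(2) sum_mono) auto
  also have "\<dots> = \<beta> / 4 + real n * H + \<beta> / 4" using n by (simp add: field_simps)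
  finally show ?thesis by (simp add: H_def)
qed

end

section \<open>The lower bound\<close>

lemma sign_answer_measurable: "sign_answer j \<in> borel_measurable borel"
proof -
  have [measurable]: "(\<lambda>y :: nat \<Rightarrow> real. y k) \<in> borel_measurable borel" for k
    by (intro borel_measurable_continuous_onI continuous_on_product_coordinates)
  show ?thesis unfolding sign_answer_def[abs_def] sgn_real_def by measurable
qed

lemma neighbors_row_update:
  assumes "i < n" "embed_row m (X i) \<noteq> embed_row m r"
  shows "neighbors (embed_matrix n m X) (embed_matrix n m (X(i := r)))"
proof -
  have "{k. k < n \<and> embed_matrix n m X ! k \<noteq> embed_matrix n m (X(i := r)) ! k} = {i}"
    using assms by auto
  then show ?thesis by (simp add: neighbors_def)
qed

lemma embed_matrix_row_update_eq:
  assumes "embed_row m (X i) = embed_row m r"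
  shows "embed_matrix n m (X(i := r)) = embed_matrix n m X"
  using assms by (auto simp: embed_matrix_def)

text \<open>Both exponents are multiples of the one quantity \<open>\<eta> * m / (n^2 * T^2)\<close>
  with \<open>\<eta> = 1 / (1000000 * lam^2)\<close>: \<open>small\<close> makes low scores
  negligible against the success probability, and the conclusion confronts that probability with the
  tail of a fresh row.\<close>

lemma private_estimator_tradeoff:
  fixes M :: "real \<Rightarrow> (nat \<Rightarrow> real) list \<Rightarrow> (nat \<Rightarrow> real) measure"
  assumes n: "n \<ge> 1" and m: "m \<ge> 1" and lam: "lam \<ge> 1" and \<beta>: "0 < \<beta>"
    and valid: "valid_mechanism (Suc m) n M" and est: "top_sv_estimator lam \<beta> (Suc m) n M"
    and dp: "\<forall>\<gamma>\<in>{0..1}. diff_private 1 (\<beta> / (4 * real n)) (datasets (Suc m) n) (M \<gamma>)"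
    and T: "T = ln (100 * real n)"
    and small: "exp (- (6 / 1000) * (real m / (1000000 * lam\<^sup>2 * (real n)\<^sup>2 * T\<^sup>2))) < \<beta> / 8"
  shows "\<beta> / 2 \<le> real n * (exp 1 * exp (- (real m / (1000000 * lam\<^sup>2 * (real n)\<^sup>2 * T\<^sup>2)) / 32))"
proof -
  define e where "e = 1 / (1000 * lam)"
  \<comment> \<open>A good prior has at most \<open>2 * \<eta> * m\<close> active columns, which is
    exactly the number of nonconstant columns allowed in
    \<open>few_nonconstant_columns\<close>.\<close>
  define \<eta> where "\<eta> = e\<^sup>2"
  have \<eta>_eq: "\<eta> = 1 / (1000000 * lam\<^sup>2)" by (simp add: \<eta>_def e_def power2_eq_square)
  have e: "0 < e" "e \<le> 1 / 1000" using lam by (auto simp: e_def field_simps)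
  have "e\<^sup>2 \<le> (1 / 1000)\<^sup>2" using e by (intro power_mono) auto
  then have \<eta>: "0 < \<eta>" "\<eta> \<le> 1 / 100" using e by (auto simp: \<eta>_def power2_eq_square)
  define c0 where "c0 = \<eta> / T"
  define \<gamma> where "\<gamma> = 4 * e"
  have \<gamma>: "\<gamma> \<in> {0..1}" using e by (simp add: \<gamma>_def)
  obtain Q :: "nat set" and \<pi> pv where prior: "finite Q" "\<forall>q\<in>Q. 0 \<le> \<pi> q \<and> \<bar>pv q\<bar> \<le> 1" "sum \<pi> Q = 1"
    "sum \<pi> {q\<in>Q. \<bar>pv q\<bar> < 1} \<le> \<eta>"
    "(\<Sum>c\<in>sign_vecs n. \<bar>\<Sum>q\<in>Q. \<pi> q * col_wt n (pv q) c * (col_score n (pv q) c - 2 * c0 * const_sign n c)\<bar>) \<le> c0 / 10"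
    using fingerprinting_prior_exists[OF n \<eta> c0_def[unfolded T]] by (elim exE conjE)
  define N where "N X = M \<gamma> (embed_matrix n m X)" for X
  have D: "embed_matrix n m X \<in> datasets (Suc m) n" if "X \<in> matrices n m" for X
    using that m unfolding matrices_def by (rule embed_matrix_in_datasets)
  have N: "prob_space (N X)" "sets (N X) = sets borel" if "X \<in> matrices n m" for X
    using valid \<gamma> D[OF that] unfolding valid_mechanism_def N_def by auto
  interpret fingerprinting_prior n m \<eta> T c0 Q \<pi> pv
    using n m \<eta> T prior by unfold_locales (auto simp: c0_def)
  interpret traced_mechanism n m \<eta> T c0 Q \<pi> pv N borel sign_answer \<beta>
  proof (intro traced_mechanism.intro traced_mechanism_axioms.intro)
    fix X i r and E :: "(nat \<Rightarrow> real) set"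
    assume X: "X \<in> matrices n m" and i: "i < n" and r: "r \<in> sign_vecs m" and E: "E \<in> sets borel"
    show "measure (N X) E \<le> exp 1 * measure (N (X(i := r))) E + \<beta> / (4 * real n)"
    \<comment> \<open>\<open>neighbors\<close> asks for exactly one differing row, so replacing a
      row by one with the same embedding is treated apart; there exp 1 >= 1 is enough.\<close>
    proof (cases "embed_row m (X i) = embed_row m r")
      case True
      have "measure (N X) E \<le> exp 1 * measure (N X) E"
        using mult_right_mono[of 1 "exp 1" "measure (N X) E"] by simp
      moreover have "0 \<le> \<beta> / (4 * real n)" using \<beta> by simp
      ultimately show ?thesis
        unfolding N_def embed_matrix_row_update_eq[of m X i r n, OF True] by linarith
    next
      case False
      have "X(i := r) \<in> matrices n m"
        using X r i unfolding matrices_def by (auto simp: PiE_def Pi_def extensional_def)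
      from dp[rule_format, OF \<gamma>, unfolded diff_private_def, rule_format, OF D[OF X] D[OF this]
          neighbors_row_update[of i n m X r, OF i False] E]
      show ?thesis unfolding N_def .
    qed
  qed (assumption | rule N sign_answer_measurable abs_sign_answer fingerprinting_prior_axioms)+
  have \<alpha>c: "\<alpha> * c0 * real m = (real m / (1000000 * lam\<^sup>2 * (real n)\<^sup>2 * T\<^sup>2)) / 100"
    by (simp add: \<alpha>_def c0_def \<eta>_eq power2_eq_square)
  have "\<beta> / 2 \<le> real n * (exp 1 * exp (- (\<eta> * real m / (32 * (real n)\<^sup>2 * T\<^sup>2))))"
  proof (rule tracing_bound)
    have "- (6 / 10) * \<alpha> * c0 * real m = - (6 / 1000) * (real m / (1000000 * lam\<^sup>2 * (real n)\<^sup>2 * T\<^sup>2))"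
      using \<alpha>c by (simp add: mult.assoc)
    then show "exp (- (6 / 10) * \<alpha> * c0 * real m) < \<beta> / 8" using small by (simp only:)
  next
    fix P X assume P: "P \<in> good_priors" and Xm: "X \<in> matrices n m" and nz: "mat_wt n m (bias_vec P) X \<noteq> 0"
    have Pp: "P \<in> priors" using P by (simp add: good_priors_def)
    have colX: "col n X j \<in> sign_vecs n" if "j < m" for j
      using Xm that by (intro col_in_sign_vecs) (auto simp: matrices_def)
    \<comment> \<open>At bias 1 or -1 a column of positive weight is constant, so nonconstant
      columns come only from active biases.\<close>
    have sub: "{j\<in>{..<m}. const_sign n (col n X j) = 0} \<subseteq> {j\<in>{..<m}. \<bar>bias_vec P j\<bar> < 1}"
    proof (rule ccontr)
      assume "\<not> ?thesis"
      then obtain j where j: "j < m" "const_sign n (col n X j) = 0" "\<not> \<bar>bias_vec P j\<bar> < 1" by auto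
      then have p: "bias_vec P j \<in> {-1, 1}" using bias_vec_le[OF Pp j(1)] by auto
      have "col_wt n (bias_vec P j) (col n X j) \<noteq> 0"
        using nz j(1) unfolding mat_wt_columns by auto
      from col_wt_unit_atom[OF colX[OF j(1)] p this] have "\<forall>i<n. col n X j i = bias_vec P j" by blast
      then show False using j(2) p by (auto simp: const_sign_def split: if_splits)
    qed
    have "card {j\<in>{..<m}. const_sign n (col n X j) = 0} \<le> num_active P"
      unfolding num_active_def by (intro card_mono sub) auto
    then have few: "real (card {j\<in>{..<m}. const_sign n (col n X j) = 0}) \<le> 2 * e\<^sup>2 * real m"
      using P unfolding good_priors_def \<eta>_def[symmetric] by simp
    interpret few_nonconstant_columns n m lam e X
      using n m lam Xm few by unfold_locales (auto simp: e_def matrices_def)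
    obtain v where v: "v \<in> unit_sphere_d (Suc m)" "\<forall>y\<in>unit_sphere_d (Suc m). Xnorm2 (Suc m) D y \<le> Xnorm2 (Suc m) D v"
      using top_singular_vector_exists[of "Suc m" D] by auto
    define Acc where "Acc = {y \<in> unit_sphere_d (Suc m). Xnorm2 (Suc m) D y \<ge> Xnorm2 (Suc m) D v - lam * \<gamma> * real n}"
    have "\<beta> \<le> measure (N X) Acc"
      unfolding N_def Acc_def
      using est[unfolded top_sv_estimator_def, rule_format, OF D[OF Xm] \<gamma> spectral_gap[folded \<gamma>_def] v(1)] v(2)
      by simp
    also have "\<dots> \<le> measure (N X) (correlated X)"
    proof -
      interpret prob_space "N X" by (rule N(1)[OF Xm])
      have "Acc \<subseteq> correlated X"
      proof
        fix y assume "y \<in> Acc"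
        then have y: "y \<in> unit_sphere_d (Suc m)" "Xnorm2 (Suc m) D y \<ge> Xnorm2 (Suc m) D u - lam * (4 * e) * real n"
          using v(2)[rule_format, OF u_sphere] by (simp_all add: Acc_def \<gamma>_def)
        show "y \<in> correlated X"
          using accurate_correlation[OF y] by (simp add: correlated_def)
      qed
      then show ?thesis using sets_events(1) N(2)[OF Xm] by (intro finite_measure_mono) auto
    qed
    finally show "\<beta> \<le> measure (N X) (correlated X)" .
  qed
  moreover have "\<eta> * real m / (32 * (real n)\<^sup>2 * T\<^sup>2) = (real m / (1000000 * lam\<^sup>2 * (real n)\<^sup>2 * T\<^sup>2)) / 32"
    by (simp add: \<eta>_eq)
  ultimately show ?thesis by (simp only: minus_divide_left)
qed

text \<open>The maximum with 2 keeps the logarithm \<open>L\<close> at least ln 2. If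
  \<open>n\<close> were smaller than claimed, both exponentials in
  \<open>private_estimator_tradeoff\<close> would be at most exp (- L), hence at most beta / (100
  n), and the tradeoff would read beta / 2 <= 3 * beta / 100.\<close>

theorem theorem1p18:
  "\<exists>c>0. \<forall>(n::nat) (d::nat) (lam::real) (beta::real)
        (M :: real \<Rightarrow> (nat \<Rightarrow> real) list \<Rightarrow> (nat \<Rightarrow> real) measure).
     n \<ge> 1 \<longrightarrow> lam \<ge> 1 \<longrightarrow> 0 < beta \<longrightarrow> beta \<le> 1 \<longrightarrow>
     valid_mechanism d n M \<longrightarrow>
     top_sv_estimator lam beta d n M \<longrightarrow>
     (\<forall>\<gamma>\<in>{0..1}. diff_private 1 (beta / (4 * real n)) (datasets d n) (M \<gamma>)) \<longrightarrow>
     real n \<ge> c * ((sqrt (real d) / lam) / (ln (max 2 (real d / (beta * lam)))) powr 1.5)"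
proof (intro exI[of _ "1 / 1000000"] conjI allI impI)
  fix n d :: nat and lam \<beta> :: real and M :: "real \<Rightarrow> (nat \<Rightarrow> real) list \<Rightarrow> (nat \<Rightarrow> real) measure"
  assume n: "n \<ge> 1" and lam: "lam \<ge> 1" and \<beta>: "0 < \<beta>" "\<beta> \<le> 1"
    and valid: "valid_mechanism d n M" and est: "top_sv_estimator lam \<beta> d n M"
    and dp: "\<forall>\<gamma>\<in>{0..1}. diff_private 1 (\<beta> / (4 * real n)) (datasets d n) (M \<gamma>)"
  define L where "L = ln (max 2 (real d / (\<beta> * lam)))"
  define x where "x = real n * lam * L powr 1.5"
  have L_half: "L \<ge> 1 / 2"
  proof -
    have "1 / 2 \<le> ln (2::real)" using ln2_ge_two_thirds by simp
    also have "\<dots> \<le> L" by (simp add: L_def)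
    finally show ?thesis .
  qed
  have Lp: "L powr 1.5 > 0" using L_half by simp
  show "1 / 1000000 * ((sqrt (real d) / lam) / (ln (max 2 (real d / (\<beta> * lam)))) powr 1.5) \<le> real n"
  proof (rule ccontr)
    assume "\<not> ?thesis"
    then have "real n < 1 / 1000000 * ((sqrt (real d) / lam) / L powr 1.5)" by (simp add: L_def)
    then have big: "1000000 * x < sqrt (real d)"
      using lam Lp by (simp add: x_def field_simps)
    have L15: "(L powr 1.5)\<^sup>2 = L ^ 3"
    proof -
      have "(L powr 1.5)\<^sup>2 = L powr (1.5 + 1.5)" by (simp only: power2_eq_square powr_add)
      also have "\<dots> = L powr (real 3)" by simp
      also have "\<dots> = L ^ 3" using L_half by (intro powr_realpow) auto
      finally show ?thesis .
    qed
    have x_ge: "real n * lam / 4 \<le> x"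
    proof -
      have "(1 / 4)\<^sup>2 \<le> (1/2 :: real) ^ 3" by (simp add: power2_eq_square power3_eq_cube)
      also have "\<dots> \<le> (L powr 1.5)\<^sup>2" unfolding L15 using L_half by (intro power_mono) auto
      finally have "1 / 4 \<le> L powr 1.5" using Lp by (intro power2_le_imp_le[of "1 / 4"]) auto
      then have "real n * lam * (1 / 4) \<le> real n * lam * L powr 1.5" using lam by (intro mult_left_mono) auto
      then show ?thesis by (simp add: x_def)
    qed
    have nlam: "real n * lam \<ge> 1" using mult_mono[of 1 "real n" 1 lam] n lam by simp
    have sd: "sqrt (real d) > 250000 * (real n * lam)" using big x_ge by linarith
    have sd1: "sqrt (real d) \<ge> 1" using sd nlam by linarith
    have d_sq: "real d = sqrt (real d) * sqrt (real d)" by simp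
    \<comment> \<open>The assumed failure makes d exceed 100 * n * lam, so logarithms in n are
      absorbed by \<open>L\<close>, which is a logarithm in d.\<close>
    have ratio: "100 * real n / \<beta> \<le> real d / (\<beta> * lam)"
    proof -
      have "100 * (real n * lam) \<le> sqrt (real d) * 1" using sd nlam by linarith
      also have "\<dots> \<le> sqrt (real d) * sqrt (real d)" using sd1 by (intro mult_left_mono) auto
      finally have "100 * (real n * lam) \<le> real d" by simp
      then show ?thesis using \<beta> lam by (simp add: field_simps)
    qed
    have L_ln: "ln (100 * real n / \<beta>) \<le> L"
      unfolding L_def using ratio n \<beta> by (intro ln_mono) auto
    define T where "T = ln (100 * real n)"
    have "100 * real n \<le> 100 * real n / \<beta>" using \<beta> n by (simp add: field_simps)
    then have "T \<le> ln (100 * real n / \<beta>)" unfolding T_def using n \<beta> by (intro ln_mono) auto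
    then have TL: "T \<le> L" using L_ln by simp
    have T0: "T > 0" using n by (simp add: T_def)
    have d2: "d \<ge> 2"
    proof (rule ccontr)
      assume "\<not> ?thesis"
      then have "sqrt (real d) \<le> sqrt 1" by (intro real_sqrt_le_mono) auto
      then show False using sd nlam unfolding real_sqrt_one by linarith
    qed
    \<comment> \<open>One coordinate is reserved for the constant entry of the embedding, which is
      why d >= 2 was secured first.\<close>
    define m where "m = d - 1"
    have d: "d = Suc m" and m: "m \<ge> 1" and dm: "real d \<le> 2 * real m" using d2 by (auto simp: m_def)
    define Z where "Z = real m / (1000000 * lam\<^sup>2 * (real n)\<^sup>2 * T\<^sup>2)"
    \<comment> \<open>The power 1.5 becomes \<open>L ^ 3\<close> after squaring: two factors
      \<open>L\<close> absorb \<open>T^2\<close>, and the third remains for the exponent.\<close>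
    have Z: "Z \<ge> 100000 * L"
    proof -
      have x2: "x\<^sup>2 = (real n)\<^sup>2 * lam\<^sup>2 * L ^ 3" unfolding x_def power_mult_distrib L15 ..
      have "(1000000 * x)\<^sup>2 \<le> (sqrt (real d))\<^sup>2" using big x_ge nlam by (intro power_mono) auto
      then have "1000000000000 * x\<^sup>2 \<le> 2 * real m" using dm by (simp add: power_mult_distrib)
      then have 1: "500000000000 * ((real n)\<^sup>2 * lam\<^sup>2 * L ^ 3) \<le> real m" unfolding x2 by linarith
      have "T\<^sup>2 \<le> L\<^sup>2" using TL T0 by (intro power_mono) auto
      then have "L * T\<^sup>2 \<le> L * L\<^sup>2" using L_half by (intro mult_left_mono) auto
      then have "(real n)\<^sup>2 * lam\<^sup>2 * (L * T\<^sup>2) \<le> (real n)\<^sup>2 * lam\<^sup>2 * L ^ 3"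
        by (intro mult_left_mono) (auto simp: power3_eq_cube power2_eq_square mult.assoc)
      then have "500000000000 * ((real n)\<^sup>2 * lam\<^sup>2 * (L * T\<^sup>2)) \<le> real m" using 1 by linarith
      moreover have "0 \<le> (real n)\<^sup>2 * lam\<^sup>2 * (L * T\<^sup>2)" using L_half by auto
      ultimately have "100000 * L * (1000000 * lam\<^sup>2 * (real n)\<^sup>2 * T\<^sup>2) \<le> real m" by (simp add: mult_ac)
      moreover have "0 < 1000000 * lam\<^sup>2 * (real n)\<^sup>2 * T\<^sup>2" using n lam T0 by simp
      ultimately show ?thesis unfolding Z_def by (simp only: pos_le_divide_eq)
    qed
    have expL: "exp (- L) \<le> \<beta> / (100 * real n)"
    proof -
      have "exp (- L) \<le> exp (- ln (100 * real n / \<beta>))" using L_ln by simp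
      also have "\<dots> = \<beta> / (100 * real n)" using n \<beta> by (simp add: exp_minus)
      finally show ?thesis .
    qed
    have small: "exp (- (6 / 1000) * Z) < \<beta> / 8"
    proof -
      have "exp (- (6 / 1000) * Z) \<le> exp (- L)" using Z L_half by simp
      also have "\<dots> \<le> \<beta> / (100 * real n)" by (rule expL)
      also have "\<dots> < \<beta> / 8" using n \<beta> by (intro divide_strict_left_mono) auto
      finally show ?thesis .
    qed
    have "\<beta> / 2 \<le> real n * (exp 1 * exp (- Z / 32))"
      using private_estimator_tradeoff[OF n m lam \<beta>(1) valid[unfolded d] est[unfolded d] dp[unfolded d] T_def]
        small unfolding Z_def by simp
    also have "\<dots> \<le> real n * (3 * (\<beta> / (100 * real n)))"
    proof (intro mult_left_mono mult_mono)
      show "exp 1 \<le> (3::real)" using exp_le by simp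
      have "exp (- Z / 32) \<le> exp (- L)" using Z L_half by simp
      then show "exp (- Z / 32) \<le> \<beta> / (100 * real n)" using expL by linarith
    qed auto
    also have "\<dots> = 3 * \<beta> / 100" using n by simp
    finally show False using \<beta> by simp
  qed
qed simp

end
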